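(* Let $T,\ell>0$. If $(f^{\mathbf p},f^{\mathbf R})\in\mathbb R^3\times\mathrm{SO}(3)$ and $(\mathbf p^0,\mathbf R^0)\in C^2([0,\ell];\mathbb R^3\times\mathrm{SO}(3))$ satisfy $$(f^{\mathbf p},f^{\mathbf R})=(\mathbf p^0,\mathbf R^0)(0),$$ then the transformation $\mathcal T:E_1\to E_2$ is bijective, where $\mathcal T$, $E_1$, $E_2$ are as follows. $$\mathcal T(\mathbf p,\mathbf R)=\begin{bmatrix}v\\ z\end{bmatrix},\qquad v=\begin{bmatrix}\mathbf R^\intercal\partial_t\mathbf p\\ \mathrm{vec}(\mathbf R^\intercal\partial_t\mathbf R)\end{bmatrix},\quad z=\mathbf C^{-1}\begin{bmatrix}\mathbf R^\intercal\partial_x\mathbf p-e_1\\ \mathrm{vec}(\mathbf R^\intercal\partial_x\mathbf R)-\Upsilon_c\end{bmatrix};$$ $E_1$ is the set of $(\mathbf p,\mathbf R)\in C^2([0,\ell]\times[0,T];\mathbb R^3\times\mathrm{SO}(3))$ such that $(\mathbf p,\mathbf R)(0,t)=(f^{\mathbf p},f^{\mathbf R})$ for all $t\in(0,T)$ and $(\mathbf p,\mathbf R)(x,0)=(\mathbf p^0,\mathbf R^0)(x)$ for all $x\in(0,\ell)$; $E_2$ is the set of $y=(v^\intercal,z^\intercal)^\intercal\in C^1([0,\ell]\times[0,T];\mathbb R^{12})$ such that, with $s:=\mathbf Cz$, $v=(v_1^\intercal,v_2^\intercal)^\intercal$, $s=(s_1^\intercal,s_2^\intercal)^\intercal$ ($v_j,s_j$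 with values in $\mathbb R^3$), $$\tfrac{\mathrm d}{\mathrm dx}\mathbf p^0=\mathbf R^0(s_1(\cdot,0)+e_1),\quad \tfrac{\mathrm d}{\mathrm dx}\mathbf R^0=\mathbf R^0(\widehat s_2(\cdot,0)+\widehat\Upsilon_c)\quad\text{in }(0,\ell),$$ $$\partial_t\begin{bmatrix}s_1\\ s_2\end{bmatrix}-\partial_x\begin{bmatrix}v_1\\ v_2\end{bmatrix}-\begin{bmatrix}\widehat\Upsilon_c&\widehat e_1\\ 0&\widehat\Upsilon_c\end{bmatrix}\begin{bmatrix}v_1\\ v_2\end{bmatrix}=-\begin{bmatrix}\widehat v_2&\widehat v_1\\ 0&\widehat v_2\end{bmatrix}\begin{bmatrix}s_1\\ s_2\end{bmatrix}\quad\text{in }(0,\ell)\times(0,T),$$ $$v_1(0,\cdot)=0,\quad v_2(0,\cdot)=0\quad\text{in }(0,T).$$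
   Context: For $u,\zeta\in\mathbb R^3$, $\widehat u$ is the skew-symmetric matrix with $\widehat u\,\zeta=u\times\zeta$, and $\mathrm{vec}(\widehat u)=u$. $e_1=(1,0,0)^\intercal$. The flexibility matrix $\mathbf C\in C^1([0,\ell];\mathbb R^{6\times6})$ has symmetric positive definite values; $R\in C^2([0,\ell];\mathrm{SO}(3))$ is given and $\Upsilon_c=\mathrm{vec}(R^\intercal\frac{\mathrm d}{\mathrm dx}R)$ is the curvature of the undeformed beam. *)

theory Defs
  imports "HOL-Analysis.Analysis"
begin

unbundle no cross3_syntax
unbundle set_product_syntax

text \<open>
  Functions of class \<open>C\<^sup>k\<close> on a set \<open>S\<close> that need not be open. Derivatives are taken within \<open>S\<close>,
  so that they are one-sided at boundary points. The first derivative is required to be of class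
  \<open>C\<^sup>k\<close> in the sense that all its directional values \<open>\<lambda>x. D x h\<close> are, which in
  finite dimension agrees with the operator-norm version. On a nondegenerate compact interval or
  rectangle the derivative within \<open>S\<close> is unique.
\<close>

primrec Ck_on :: "nat \<Rightarrow> 'a::euclidean_space set \<Rightarrow> ('a \<Rightarrow> 'b::euclidean_space) \<Rightarrow> bool" where
  "Ck_on 0 S f \<longleftrightarrow> continuous_on S f"
| "Ck_on (Suc k) S f \<longleftrightarrow>
     (\<exists>D. (\<forall>x\<in>S. (f has_derivative D x) (at x within S)) \<and> (\<forall>h. Ck_on k S (\<lambda>x. D x h)))"

text \<open>
  The space \<open>\<real>\<^sup>6\<close> is rendered as \<^typ>\<open>real^(3 + 3)\<close> and \<open>\<real>\<^sup>1\<^sup>2\<close> as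
  \<^typ>\<open>real^((3 + 3) + (3 + 3))\<close>: in an index type, \<open>+\<close> is the disjoint sum of types, and
  \<^const>\<open>Inl\<close>, \<^const>\<open>Inr\<close> select the first and the second block of coordinates.
\<close>

definition stack :: "'a^'m::finite \<Rightarrow> 'a^'n::finite \<Rightarrow> 'a^('m + 'n)" where
  "stack u w = (\<chi> i. case i of Inl j \<Rightarrow> u $ j | Inr j \<Rightarrow> w $ j)"

definition upper :: "'a^('m::finite + 'n::finite) \<Rightarrow> 'a^'m" where
  "upper y = (\<chi> i. y $ Inl i)"

definition lower :: "'a^('m::finite + 'n::finite) \<Rightarrow> 'a^'n" where
  "lower y = (\<chi> i. y $ Inr i)"

definition block_matrix ::
  "'a^'n::finite^'m::finite \<Rightarrow> 'a^'p::finite^'m \<Rightarrow> 'a^'n^'q::finite \<Rightarrow> 'a^'p^'q \<Rightarrow> 'a^('n + 'p)^('m + 'q)" where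
  "block_matrix A11 A12 A21 A22 =
     (\<chi> i. case i of Inl j \<Rightarrow> stack (A11 $ j) (A12 $ j) | Inr j \<Rightarrow> stack (A21 $ j) (A22 $ j))"

lemma upper_stack [simp]: "upper (stack u w) = u"
  and lower_stack [simp]: "lower (stack u w) = w"
  by (simp_all add: upper_def lower_def stack_def vec_eq_iff)

lemma stack_upper_lower [simp]: "stack (upper y) (lower y) = y"
  by (simp add: upper_def lower_def stack_def vec_eq_iff split: sum.split)

lemma block_matrix_mult_stack:
  fixes A11 :: "'a::semiring_1^'n^'m" and A12 :: "'a^'p^'m"
    and A21 :: "'a^'n^'q" and A22 :: "'a^'p^'q"
  shows "block_matrix A11 A12 A21 A22 *v stack u w =
           stack (A11 *v u + A12 *v w) (A21 *v u + A22 *v w)"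
proof -
  have split: "(\<Sum>i\<in>UNIV. f i) = (\<Sum>j\<in>UNIV. f (Inl j)) + (\<Sum>j\<in>UNIV. f (Inr j))"
    for f :: "'n + 'p \<Rightarrow> 'a"
    by (subst UNIV_Plus_UNIV [symmetric], subst sum.Plus) simp_all
  show ?thesis
    unfolding vec_eq_iff matrix_vector_mult_def split
    by (auto simp: block_matrix_def stack_def split: sum.split)
qed

definition hat :: "real^3 \<Rightarrow> real^3^3" where
  "hat u = matrix (cross3 u)"

text \<open>Only the values of the following function on skew-symmetric matrices are meaningful.\<close>

definition vec_of_skew :: "real^3^3 \<Rightarrow> real^3" where
  "vec_of_skew = inv hat"

lemma hat_mult: "hat u *v w = cross3 u w"
  proof -
  have "linear (cross3 u)"
    by (rule linearI) (simp_all add: cross_add_right cross_mult_right)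
  then show ?thesis
    by (simp add: hat_def matrix_vector_mul)
qed

lemma vec_of_skew_hat: "vec_of_skew (hat u) = u"
proof -
  have "inj hat"
  proof (rule injI)
    fix u w assume "hat u = hat w"
    then have "cross3 u z = cross3 w z" for z
      by (simp flip: hat_mult)
    from this[of "axis 1 1"] this[of "axis 2 1"] show "u = w"
      by (simp add: cross3_def vec_eq_iff forall_3 axis_def)
  qed
  then show ?thesis
    by (simp add: vec_of_skew_def)
qed

lemma hat_eq: "hat u = vector [vector [0, - u $ 3, u $ 2],
                               vector [u $ 3, 0, - u $ 1],
                               vector [- u $ 2, u $ 1, 0]]"
  by (simp add: hat_def matrix_def cross3_def vec_eq_iff forall_3 axis_def)

definition e1 :: "real^3" where
  "e1 = axis 1 1"

definition curvature :: "real \<Rightarrow> (real \<Rightarrow> real^3^3) \<Rightarrow> real \<Rightarrow> real^3" where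
  "curvature l R x =
     vec_of_skew (transpose (R x) ** vector_derivative R (at x within {0..l}))"

text \<open>
  Points of the space-time rectangle are pairs \<open>(x, t)\<close>. Partial derivatives are one-sided
  on the boundary.
\<close>

definition rect :: "real \<Rightarrow> real \<Rightarrow> (real \<times> real) set" where
  "rect l T = {0..l} \<times> {0..T}"

definition partial_x :: "real \<Rightarrow> (real \<times> real \<Rightarrow> 'a::real_normed_vector) \<Rightarrow> real \<times> real \<Rightarrow> 'a" where
  "partial_x l f = (\<lambda>(x, t). vector_derivative (\<lambda>\<xi>. f (\<xi>, t)) (at x within {0..l}))"

definition partial_t :: "real \<Rightarrow> (real \<times> real \<Rightarrow> 'a::real_normed_vector) \<Rightarrow> real \<times> real \<Rightarrow> 'a" where
  "partial_t T f = (\<lambda>(x, t). vector_derivative (\<lambda>\<tau>. f (x, \<tau>)) (at t within {0..T}))"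

text \<open>
  A map with domain the rectangle is represented by the total function that is \<^term>\<open>undefined\<close>
  outside of it (\<^const>\<open>extensional\<close>, \<^const>\<open>restrict\<close>), so that two elements of a function space
  are equal iff they agree on the rectangle.
\<close>

definition E1 ::
  "real \<Rightarrow> real \<Rightarrow> real^3 \<Rightarrow> real^3^3 \<Rightarrow> (real \<Rightarrow> real^3) \<Rightarrow> (real \<Rightarrow> real^3^3) \<Rightarrow>
   (real \<times> real \<Rightarrow> (real^3) \<times> (real^3^3)) set" where
  "E1 l T fp fR p0 R0 =
     {P \<in> extensional (rect l T).
        Ck_on 2 (rect l T) P \<and>
        (\<forall>q\<in>rect l T. rotation_matrix (snd (P q))) \<and>
        (\<forall>t\<in>{0<..<T}. P (0, t) = (fp, fR)) \<and>
        (\<forall>x\<in>{0<..<l}. P (x, 0) = (p0 x, R0 x))}"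

definition E2 ::
  "real \<Rightarrow> real \<Rightarrow> (real \<Rightarrow> real^(3 + 3)^(3 + 3)) \<Rightarrow> (real \<Rightarrow> real^3^3) \<Rightarrow>
   (real \<Rightarrow> real^3) \<Rightarrow> (real \<Rightarrow> real^3^3) \<Rightarrow>
   (real \<times> real \<Rightarrow> real^((3 + 3) + (3 + 3))) set" where
  "E2 l T C R p0 R0 =
     {y \<in> extensional (rect l T).
        Ck_on 1 (rect l T) y \<and>
        (let v = (\<lambda>q. upper (y q)); v1 = (\<lambda>q. upper (v q)); v2 = (\<lambda>q. lower (v q));
             z = (\<lambda>q. lower (y q));
             s = (\<lambda>(x, t). C x *v z (x, t)); s1 = (\<lambda>q. upper (s q)); s2 = (\<lambda>q. lower (s q));
             \<Upsilon> = curvature l R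
         in (\<forall>x\<in>{0<..<l}.
               vector_derivative p0 (at x within {0..l}) = R0 x *v (s1 (x, 0) + e1) \<and>
               vector_derivative R0 (at x within {0..l}) = R0 x ** (hat (s2 (x, 0)) + hat (\<Upsilon> x))) \<and>
            (\<forall>x\<in>{0<..<l}. \<forall>t\<in>{0<..<T}.
               partial_t T s (x, t) - partial_x l v (x, t)
                 - block_matrix (hat (\<Upsilon> x)) (hat e1) 0 (hat (\<Upsilon> x)) *v v (x, t)
               = - (block_matrix (hat (v2 (x, t))) (hat (v1 (x, t))) 0 (hat (v2 (x, t))) *v s (x, t))) \<and>
            (\<forall>t\<in>{0<..<T}. v1 (0, t) = 0 \<and> v2 (0, t) = 0))}"

definition transf ::
  "real \<Rightarrow> real \<Rightarrow> (real \<Rightarrow> real^(3 + 3)^(3 + 3)) \<Rightarrow> (real \<Rightarrow> real^3^3) \<Rightarrow>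
   (real \<times> real \<Rightarrow> (real^3) \<times> (real^3^3)) \<Rightarrow>
   (real \<times> real \<Rightarrow> real^((3 + 3) + (3 + 3)))" where
  "transf l T C R P =
     (let p = (\<lambda>q. fst (P q)); Q = (\<lambda>q. snd (P q));
          v = (\<lambda>q. stack (transpose (Q q) *v partial_t T p q)
                         (vec_of_skew (transpose (Q q) ** partial_t T Q q)));
          z = (\<lambda>(x, t). matrix_inv (C x) *v
                 stack (transpose (Q (x, t)) *v partial_x l p (x, t) - e1)
                       (vec_of_skew (transpose (Q (x, t)) ** partial_x l Q (x, t)) - curvature l R x))
      in restrict (\<lambda>q. stack (v q) (z q)) (rect l T))"

end

theory Submission
  imports Defs
begin

text \<open>
  Put \<open>\<sigma>\<^sub>1 = s\<^sub>1 + e\<^sub>1\<close>, \<open>\<sigma>\<^sub>2 = s\<^sub>2 + \<Upsilon>\<close>. Then \<open>\<T>(p, Q) = y\<close> says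
  \<open>p\<^sub>x = Q \<sigma>\<^sub>1\<close>, \<open>p\<^sub>t = Q v\<^sub>1\<close>, \<open>Q\<^sub>x = Q \<sigma>\<^sub>2\<close>, \<open>Q\<^sub>t = Q v\<^sub>2\<close> (hats omitted),
  and the balance laws in \<open>E\<^sub>2\<close> are the compatibility conditions of this overdetermined system.
  They hold by symmetry of second derivatives, so \<open>\<T>\<close> maps into \<open>E\<^sub>2\<close>. Two rotations
  solving \<open>Q\<^sub>x = Q \<sigma>\<^sub>2\<close> with \<open>\<sigma>\<^sub>2\<close> skew have constant \<open>Q Q'\<^sup>T\<close>, which gives injectivity.
  For surjectivity solve \<open>Q\<^sub>x = Q \<sigma>\<^sub>2\<close>, \<open>Q(0, t) = f\<^sup>R\<close> for each \<open>t\<close> by Picard iteration. For fixed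
  \<open>t\<^sub>0\<close>, \<open>Q(x, t) Q(x, t\<^sub>0)\<^sup>T\<close> solves a linear equation whose coefficient vanishes at \<open>t = t\<^sub>0\<close>;
  its \<open>t\<close>-derivative at \<open>t\<^sub>0\<close> is \<open>\<integral> Q (\<sigma>\<^sub>2)\<^sub>t Q\<^sup>T\<close>, and the compatibility condition turns the
  integrand into \<open>(Q v\<^sub>2 Q\<^sup>T)\<^sub>x\<close>, so \<open>Q\<^sub>t = Q v\<^sub>2\<close>. The position is then a primitive of a closed form.
\<close>

section \<open>Calculus of \<open>C\<^sup>k\<close> functions\<close>

lemma Ck_on_SucE:
  assumes "Ck_on (Suc k) S f"
  obtains D where "\<And>x. x \<in> S \<Longrightarrow> (f has_derivative D x) (at x within S)"
    and "\<And>h. Ck_on k S (\<lambda>x. D x h)"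
  using assms by auto

lemma Ck_on_SucI:
  assumes "\<And>x. x \<in> S \<Longrightarrow> (f has_derivative D x) (at x within S)"
    and "\<And>h. Ck_on k S (\<lambda>x. D x h)"
  shows "Ck_on (Suc k) S f"
  using assms by auto

text \<open>Derivatives are taken within \<open>S\<close>, so only values on \<open>S\<close> count.
  This lets formulas that are valid only on the rectangle decide the class of a map.\<close>

lemma Ck_on_cong:
  assumes "\<And>x. x \<in> S \<Longrightarrow> f x = g x"
  shows "Ck_on k S f \<longleftrightarrow> Ck_on k S g"
proof (cases k)
  case 0
  then show ?thesis using assms by (simp cong: continuous_on_cong)
next
  case (Suc m)
  have "(f has_derivative D x) (at x within S) \<longleftrightarrow> (g has_derivative D x) (at x within S)"
    if "x \<in> S" for D x
    using that assms by (metis has_derivative_transform)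
  then show ?thesis by (simp add: Suc)
qed

lemma Ck_on_Suc_imp: "Ck_on (Suc k) S f \<Longrightarrow> Ck_on k S f"
proof (induction k arbitrary: f)
  case 0
  then show ?case using has_derivative_continuous_on by auto
next
  case (Suc k)
  from Suc.prems obtain D where "\<And>x. x \<in> S \<Longrightarrow> (f has_derivative D x) (at x within S)"
    and "\<And>h. Ck_on (Suc k) S (\<lambda>x. D x h)" by (rule Ck_on_SucE) blast
  then show ?case by (blast intro: Ck_on_SucI[of S f D] Suc.IH)
qed

lemma Ck_on_imp_continuous_on: "Ck_on k S f \<Longrightarrow> continuous_on S f"
  by (induction k) (simp, metis Ck_on_Suc_imp)

lemma Ck_on_const: "Ck_on k S (\<lambda>x. c)"
proof (induction k arbitrary: c)
  case (Suc k)
  show ?case by (auto intro!: exI[of _ "\<lambda>x h. 0"] Suc)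
qed simp

lemma Ck_on_linear:
  assumes L: "bounded_linear L"
  shows "Ck_on k S f \<Longrightarrow> Ck_on k S (\<lambda>x. L (f x))"
proof (induction k arbitrary: f)
  case 0
  then show ?case using bounded_linear.continuous_on[OF L] by simp
next
  case (Suc k)
  from Suc.prems obtain D where "\<And>x. x \<in> S \<Longrightarrow> (f has_derivative D x) (at x within S)"
    and "\<And>h. Ck_on k S (\<lambda>x. D x h)" by (rule Ck_on_SucE) blast
  then show ?case
    by (intro Ck_on_SucI[of _ _ "\<lambda>x h. L (D x h)"] Suc.IH bounded_linear.has_derivative[OF L])
qed

text \<open>Meant for projections: with \<open>fst\<close> it turns functions of x on the interval
  into functions on the rectangle.\<close>

lemma Ck_on_compose_linear:
  assumes L: "bounded_linear L" and S: "L ` S \<subseteq> S'"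
  shows "Ck_on k S' f \<Longrightarrow> Ck_on k S (\<lambda>x. f (L x))"
proof (induction k arbitrary: f)
  case 0
  then show ?case
    using continuous_on_compose2[OF _ bounded_linear.continuous_on[OF L continuous_on_id] S] by simp
next
  case (Suc k)
  from Suc.prems obtain D where D: "\<And>x. x \<in> S' \<Longrightarrow> (f has_derivative D x) (at x within S')"
    and C: "\<And>h. Ck_on k S' (\<lambda>x. D x h)" by (rule Ck_on_SucE) blast
  have "((\<lambda>x. f (L x)) has_derivative (\<lambda>h. D (L x) (L h))) (at x within S)" if "x \<in> S" for x
    using has_derivative_in_compose[OF bounded_linear_imp_has_derivative[OF L], of f "D (L x)" x S]
      has_derivative_subset[OF D S, of "L x"] S that by auto
  moreover have "Ck_on k S (\<lambda>x. D (L x) (L h))" for h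
    using Suc.IH[OF C] .
  ultimately show ?case by (rule Ck_on_SucI)
qed

lemma Ck_on_add: "Ck_on k S f \<Longrightarrow> Ck_on k S g \<Longrightarrow> Ck_on k S (\<lambda>x. f x + g x)"
proof (induction k arbitrary: f g)
  case 0
  then show ?case by (simp add: continuous_on_add)
next
  case (Suc k)
  from Suc.prems obtain D E where "\<And>x. x \<in> S \<Longrightarrow> (f has_derivative D x) (at x within S)"
    and "\<And>h. Ck_on k S (\<lambda>x. D x h)" "\<And>x. x \<in> S \<Longrightarrow> (g has_derivative E x) (at x within S)"
    and "\<And>h. Ck_on k S (\<lambda>x. E x h)" by (elim Ck_on_SucE) blast
  then show ?case
    by (intro Ck_on_SucI[of _ _ "\<lambda>x h. D x h + E x h"] Suc.IH has_derivative_add)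
qed

lemma Ck_on_minus: "Ck_on k S f \<Longrightarrow> Ck_on k S (\<lambda>x. - f x)"
  by (rule Ck_on_linear) (simp_all add: bounded_linear_minus)

lemma Ck_on_diff: "Ck_on k S f \<Longrightarrow> Ck_on k S g \<Longrightarrow> Ck_on k S (\<lambda>x. f x - g x)"
  using Ck_on_add[of k S f "\<lambda>x. - g x"] Ck_on_minus[of k S g] by simp

lemma Ck_on_sum: "(\<And>i. i \<in> I \<Longrightarrow> Ck_on k S (f i)) \<Longrightarrow> Ck_on k S (\<lambda>x. \<Sum>i\<in>I. f i x)"
  by (induction I rule: infinite_finite_induct) (auto intro: Ck_on_const Ck_on_add)

lemma Ck_on_bilinear:
  fixes B :: "'a::euclidean_space \<Rightarrow> 'b::euclidean_space \<Rightarrow> 'c::euclidean_space"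
  assumes B: "bounded_bilinear B"
  shows "Ck_on k S f \<Longrightarrow> Ck_on k S g \<Longrightarrow> Ck_on k S (\<lambda>x. B (f x) (g x))"
proof (induction k arbitrary: f g)
  case 0
  then show ?case using bounded_bilinear.continuous_on[OF B] by simp
next
  case (Suc k)
  have "Ck_on k S f" "Ck_on k S g" using Suc.prems Ck_on_Suc_imp by blast+
  moreover from Suc.prems obtain D E where "\<And>x. x \<in> S \<Longrightarrow> (f has_derivative D x) (at x within S)"
    and "\<And>h. Ck_on k S (\<lambda>x. D x h)" "\<And>x. x \<in> S \<Longrightarrow> (g has_derivative E x) (at x within S)"
    and "\<And>h. Ck_on k S (\<lambda>x. E x h)" by (elim Ck_on_SucE) blast
  ultimately show ?case
    by (intro Ck_on_SucI[of _ _ "\<lambda>x h. B (f x) (E x h) + B (D x h) (g x)"]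
        Ck_on_add Suc.IH bounded_bilinear.FDERIV[OF B])
qed

lemma Ck_on_mult:
  fixes f g :: "'a::euclidean_space \<Rightarrow> real"
  shows "Ck_on k S f \<Longrightarrow> Ck_on k S g \<Longrightarrow> Ck_on k S (\<lambda>x. f x * g x)"
  by (rule Ck_on_bilinear[OF bounded_bilinear_mult])

lemma Ck_on_prod:
  fixes f :: "'i \<Rightarrow> 'a::euclidean_space \<Rightarrow> real"
  shows "(\<And>i. i \<in> I \<Longrightarrow> Ck_on k S (f i)) \<Longrightarrow> Ck_on k S (\<lambda>x. \<Prod>i\<in>I. f i x)"
  by (induction I rule: infinite_finite_induct) (auto intro: Ck_on_const Ck_on_mult)

lemma Ck_on_inverse:
  fixes f :: "'a::euclidean_space \<Rightarrow> real"
  assumes "\<And>x. x \<in> S \<Longrightarrow> f x \<noteq> 0"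
  shows "Ck_on k S f \<Longrightarrow> Ck_on k S (\<lambda>x. inverse (f x))"
proof (induction k)
  case 0
  then show ?case using assms by (simp add: continuous_on_inverse)
next
  case (Suc k)
  then have "Ck_on k S (\<lambda>x. inverse (f x))" using Ck_on_Suc_imp by blast
  moreover from Suc.prems obtain D where "\<And>x. x \<in> S \<Longrightarrow> (f has_derivative D x) (at x within S)"
    and "\<And>h. Ck_on k S (\<lambda>x. D x h)" by (rule Ck_on_SucE) blast
  ultimately show ?case
    by (intro Ck_on_SucI[of _ _ "\<lambda>x h. - (inverse (f x) * D x h * inverse (f x))"]
        Ck_on_minus Ck_on_mult Deriv.has_derivative_inverse assms)
qed

lemma Ck_on_vec_nth:
  fixes f :: "'a::euclidean_space \<Rightarrow> 'b::euclidean_space^'n"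
  shows "Ck_on k S f \<Longrightarrow> Ck_on k S (\<lambda>x. f x $ i)"
  by (rule Ck_on_linear[OF bounded_linear_vec_nth])

lemma Ck_on_vec_lambda:
  fixes f :: "'n::finite \<Rightarrow> 'a::euclidean_space \<Rightarrow> 'b::euclidean_space"
  assumes "\<And>i. Ck_on k S (f i)"
  shows "Ck_on k S (\<lambda>x. \<chi> i. f i x)"
proof -
  \<comment> \<open>The vector is a sum of coordinate injections applied to its entries, so the
    rules for sums and linear maps apply.\<close>
  have *: "(\<chi> i. f i x) = (\<Sum>j\<in>UNIV. \<chi> i. if i = j then f j x else 0)" for x
    by (simp add: vec_eq_iff sum.delta')
  have "linear (\<lambda>c::'b. (\<chi> i. if i = j then c else 0)::'b^'n)" for j
    by (rule linearI) (auto simp: vec_eq_iff)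
  then show ?thesis
    unfolding * by (intro Ck_on_sum Ck_on_linear[OF _ assms]) (simp add: linear_conv_bounded_linear)
qed

lemma Ck_on_Pair: "Ck_on k S f \<Longrightarrow> Ck_on k S g \<Longrightarrow> Ck_on k S (\<lambda>x. (f x, g x))"
  using Ck_on_add[OF Ck_on_linear[of "\<lambda>u. (u, 0)" k S f] Ck_on_linear[of "\<lambda>u. (0, u)" k S g]]
  by (simp add: bounded_linear_Pair bounded_linear_ident bounded_linear_zero)

section \<open>Matrix-valued functions and the inverse matrix\<close>

lemma bounded_bilinear_matrix_vector_mult:
  "bounded_bilinear ((*v) :: real^'n^'m \<Rightarrow> real^'n \<Rightarrow> real^'m)"
  by (rule bilinear_conv_bounded_bilinear[THEN iffD1])
     (auto simp: bilinear_def matrix_vector_right_distrib matrix_vector_mult_add_rdistrib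
        matrix_vector_mult_scaleR scaleR_matrix_vector_assoc intro!: linearI)

lemma bounded_bilinear_matrix_mult:
  "bounded_bilinear ((**) :: real^'n^'m \<Rightarrow> real^'p^'n \<Rightarrow> real^'p^'m)"
  by (rule bilinear_conv_bounded_bilinear[THEN iffD1])
     (auto simp: bilinear_def vec_eq_iff matrix_matrix_mult_def sum.distrib sum_distrib_left
        distrib_left distrib_right mult.left_commute mult.assoc intro!: linearI)

lemma bounded_linear_transpose: "bounded_linear (transpose :: real^'n^'m \<Rightarrow> real^'m^'n)"
  by (auto simp: linear_conv_bounded_linear[symmetric] transpose_def vec_eq_iff intro!: linearI)

lemma matrix_inv_right:
  fixes A :: "'a::semiring_1^'n^'m"
  assumes "invertible A"
  shows "A ** matrix_inv A = mat 1"
  using assms unfolding invertible_def matrix_inv_def by (rule someI2_ex) blast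

lemma matrix_inv_left:
  fixes A :: "'a::semiring_1^'n^'m"
  assumes "invertible A"
  shows "matrix_inv A ** A = mat 1"
  using assms unfolding invertible_def matrix_inv_def by (rule someI2_ex) blast

lemma Ck_on_det:
  fixes A :: "'a::euclidean_space \<Rightarrow> real^'n^'n"
  shows "Ck_on k S A \<Longrightarrow> Ck_on k S (\<lambda>x. det (A x))"
  unfolding det_def by (intro Ck_on_sum Ck_on_mult Ck_on_const Ck_on_prod Ck_on_vec_nth)

text \<open>By Cramer's rule each coordinate is a quotient of determinants, that is, of polynomials
  in the entries of \<open>A x\<close> and \<open>w x\<close>. No derivative of the inverse matrix
  has to be computed.\<close>

lemma Ck_on_matrix_inv_mult:
  fixes A :: "'a::euclidean_space \<Rightarrow> real^'n^'n"
  assumes A: "Ck_on k S A" and w: "Ck_on k S w" and inv: "\<And>x. x \<in> S \<Longrightarrow> invertible (A x)"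
  shows "Ck_on k S (\<lambda>x. matrix_inv (A x) *v w x)"
proof -
  have det: "det (A x) \<noteq> 0" if "x \<in> S" for x
    using inv that invertible_det_nz by blast
  have "matrix_inv (A x) *v w x =
      (\<chi> j. det (\<chi> i m. if m = j then w x $ i else A x $ i $ m) * inverse (det (A x)))"
    if "x \<in> S" for x
  proof -
    have "A x *v (matrix_inv (A x) *v w x) = w x"
      using matrix_inv_right[OF inv[OF that]] by (simp add: matrix_vector_mul_assoc)
    then show ?thesis
      using cramer[OF det[OF that]] by (simp add: divide_inverse)
  qed
  moreover have "Ck_on k S (\<lambda>x. if m = j then w x $ i else A x $ i $ m)" for m i j
    by (cases "m = j") (auto intro!: Ck_on_vec_nth A w)
  then have "Ck_on k S (\<lambda>x. \<chi> j. det (\<chi> i m. if m = j then w x $ i else A x $ i $ m) * inverse (det (A x)))"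
    by (intro Ck_on_vec_lambda Ck_on_mult Ck_on_inverse Ck_on_det det A)
  ultimately show ?thesis
    by (rule Ck_on_cong[THEN iffD2])
qed

section \<open>Partial derivatives and symmetry of second derivatives on the rectangle\<close>

lemma has_vector_derivative_imp_bound:
  fixes f :: "real \<Rightarrow> 'a::real_normed_vector"
  assumes "convex S" "\<And>x. x \<in> S \<Longrightarrow> (f has_vector_derivative f' x) (at x within S)"
    and "\<And>x. x \<in> S \<Longrightarrow> norm (f' x) \<le> B" and "x \<in> S" "y \<in> S"
  shows "norm (f x - f y) \<le> B * \<bar>x - y\<bar>"
proof -
  have "onorm (\<lambda>h. h *\<^sub>R f' u) \<le> B" if "u \<in> S" for u
  proof (rule onorm_bound)
    show "0 \<le> B" using assms(3)[OF that] norm_ge_zero order_trans by blast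
    show "norm (h *\<^sub>R f' u) \<le> B * norm h" for h
      using mult_right_mono[OF assms(3)[OF that], of "\<bar>h\<bar>"] by (simp add: mult.commute)
  qed
  with differentiable_bound[of S f "\<lambda>x h. h *\<^sub>R f' x" B x y] assms show ?thesis
    by (simp add: has_vector_derivative_def)
qed

lemma partial_x_eqI:
  fixes f :: "real \<times> real \<Rightarrow> 'a::euclidean_space"
  assumes "l > 0" "x \<in> {0..l}" "((\<lambda>\<xi>. f (\<xi>, t)) has_vector_derivative d) (at x within {0..l})"
  shows "partial_x l f (x, t) = d"
  using vector_derivative_within_closed_interval[OF assms] by (simp add: partial_x_def)

lemma partial_t_eqI:
  fixes f :: "real \<times> real \<Rightarrow> 'a::euclidean_space"
  assumes "T > 0" "t \<in> {0..T}" "((\<lambda>\<tau>. f (x, \<tau>)) has_vector_derivative d) (at t within {0..T})"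
  shows "partial_t T f (x, t) = d"
  using vector_derivative_within_closed_interval[OF assms] by (simp add: partial_t_def)

text \<open>Composing with the segments parallel to the axes identifies the partial derivatives at
  \<open>q\<close> with \<open>D q (1, 0)\<close> and \<open>D q (0, 1)\<close>, which are of class
  \<open>k\<close> by the definition of \<open>Ck_on\<close>.\<close>

lemma Ck_on_rect_partials:
  assumes pos: "l > 0" "T > 0" and f: "Ck_on (Suc k) (rect l T) f"
  shows Ck_on_partial_x: "Ck_on k (rect l T) (partial_x l f)"
    and Ck_on_partial_t: "Ck_on k (rect l T) (partial_t T f)"
    and has_partial_x: "\<And>x t. x \<in> {0..l} \<Longrightarrow> t \<in> {0..T} \<Longrightarrow>
      ((\<lambda>\<xi>. f (\<xi>, t)) has_vector_derivative partial_x l f (x, t)) (at x within {0..l})"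
    and has_partial_t: "\<And>x t. x \<in> {0..l} \<Longrightarrow> t \<in> {0..T} \<Longrightarrow>
      ((\<lambda>\<tau>. f (x, \<tau>)) has_vector_derivative partial_t T f (x, t)) (at t within {0..T})"
proof -
  from f obtain D where D: "\<And>q. q \<in> rect l T \<Longrightarrow> (f has_derivative D q) (at q within rect l T)"
    and C: "\<And>h. Ck_on k (rect l T) (\<lambda>q. D q h)" by (rule Ck_on_SucE) blast
  have dx: "((\<lambda>\<xi>. f (\<xi>, t)) has_vector_derivative D (x, t) (1, 0)) (at x within {0..l})"
    if "x \<in> {0..l}" "t \<in> {0..T}" for x t
  proof -
    have "((\<lambda>\<xi>. f (\<xi>, t)) has_derivative (\<lambda>h. D (x, t) (h, 0))) (at x within {0..l})"
      by (rule has_derivative_in_compose2[OF D _ _ has_derivative_Pair[OF has_derivative_ident has_derivative_const]])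
         (use that in \<open>auto simp: rect_def\<close>)
    moreover have "(\<lambda>h. D (x, t) (h, 0)) = (\<lambda>h. h *\<^sub>R D (x, t) (1, 0))"
    proof
      show "D (x, t) (h, 0) = h *\<^sub>R D (x, t) (1, 0)" for h
        using linear_scale[OF has_derivative_linear[OF D[of "(x, t)"]], of h "(1, 0)"] that
        by (simp add: rect_def)
    qed
    ultimately show ?thesis by (simp only: has_vector_derivative_def)
  qed
  have dt: "((\<lambda>\<tau>. f (x, \<tau>)) has_vector_derivative D (x, t) (0, 1)) (at t within {0..T})"
    if "x \<in> {0..l}" "t \<in> {0..T}" for x t
  proof -
    have "((\<lambda>\<tau>. f (x, \<tau>)) has_derivative (\<lambda>h. D (x, t) (0, h))) (at t within {0..T})"
      by (rule has_derivative_in_compose2[OF D _ _ has_derivative_Pair[OF has_derivative_const has_derivative_ident]])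
         (use that in \<open>auto simp: rect_def\<close>)
    moreover have "(\<lambda>h. D (x, t) (0, h)) = (\<lambda>h. h *\<^sub>R D (x, t) (0, 1))"
    proof
      show "D (x, t) (0, h) = h *\<^sub>R D (x, t) (0, 1)" for h
        using linear_scale[OF has_derivative_linear[OF D[of "(x, t)"]], of h "(0, 1)"] that
        by (simp add: rect_def)
    qed
    ultimately show ?thesis by (simp only: has_vector_derivative_def)
  qed
  have eqs: "partial_x l f q = D q (1, 0)" "partial_t T f q = D q (0, 1)" if "q \<in> rect l T" for q
    using that pos by (auto simp: rect_def intro!: partial_x_eqI partial_t_eqI dx dt)
  show "Ck_on k (rect l T) (partial_x l f)" "Ck_on k (rect l T) (partial_t T f)"
    by (rule Ck_on_cong[THEN iffD2, OF eqs(1) C] Ck_on_cong[THEN iffD2, OF eqs(2) C], assumption)+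
  fix x t assume "x \<in> {0..l}" "t \<in> {0..T}"
  then show "((\<lambda>\<xi>. f (\<xi>, t)) has_vector_derivative partial_x l f (x, t)) (at x within {0..l})"
    and "((\<lambda>\<tau>. f (x, \<tau>)) has_vector_derivative partial_t T f (x, t)) (at t within {0..T})"
    using dx dt eqs[of "(x, t)"] by (auto simp: rect_def)
qed

text \<open>Converse of the previous lemma: existing partial derivatives combine into a total
  derivative because the one in t is jointly continuous. Every directional value is then a linear
  combination of \<open>fx\<close> and \<open>ft\<close>.\<close>

lemma Ck_on_rectI:
  assumes fx: "\<And>x t. x \<in> {0..l} \<Longrightarrow> t \<in> {0..T} \<Longrightarrow>
      ((\<lambda>\<xi>. f (\<xi>, t)) has_vector_derivative fx (x, t)) (at x within {0..l})"
    and ft: "\<And>x t. x \<in> {0..l} \<Longrightarrow> t \<in> {0..T} \<Longrightarrow>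
      ((\<lambda>\<tau>. f (x, \<tau>)) has_vector_derivative ft (x, t)) (at t within {0..T})"
    and Cx: "Ck_on k (rect l T) fx" and Ct: "Ck_on k (rect l T) ft"
  shows "Ck_on (Suc k) (rect l T) f"
proof (rule Ck_on_SucI)
  show "Ck_on k (rect l T) (\<lambda>q. fst h *\<^sub>R fx q + snd h *\<^sub>R ft q)" for h :: "real \<times> real"
    by (intro Ck_on_add Ck_on_linear[OF bounded_linear_scaleR_right] Cx Ct)
  have "continuous_on (rect l T) ft" using Ct Ck_on_imp_continuous_on by blast
  then have cont: "continuous_on ({0..l} \<times> {0..T}) (\<lambda>(x, t). blinfun_scaleR_left (ft (x, t)))"
    unfolding rect_def case_prod_eta split_beta by (intro continuous_intros) auto
  show "(f has_derivative (\<lambda>h. fst h *\<^sub>R fx q + snd h *\<^sub>R ft q)) (at q within rect l T)"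
    if qR: "q \<in> rect l T" for q
  proof -
    obtain x t where q: "q = (x, t)" "x \<in> {0..l}" "t \<in> {0..T}" using qR unfolding rect_def by blast
    have "((\<lambda>(x, t). f (x, t)) has_derivative
        (\<lambda>(a, b). a *\<^sub>R fx (x, t) + blinfun_scaleR_left (ft (x, t)) b)) (at (x, t) within {0..l} \<times> {0..T})"
    proof (rule has_derivative_partialsI)
      show "continuous (at (x, t) within {0..l} \<times> {0..T}) (\<lambda>(x, t). blinfun_scaleR_left (ft (x, t)))"
        using cont q unfolding continuous_on_eq_continuous_within by blast
    qed (use q fx ft in \<open>auto simp: has_vector_derivative_def\<close>)
    then show ?thesis by (simp add: q rect_def case_prod_beta')
  qed
qed

text \<open>Differentiating \<open>F x t = F 0 t + \<integral> g\<close> under the integral sign, phrased so that no integral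
  occurs: the increment \<open>F x t - F x t0 - (t - t0) h x\<close> vanishes at \<open>x = 0\<close> and has a small derivative.\<close>

lemma has_vector_derivative_parameter:
  fixes F :: "real \<Rightarrow> real \<Rightarrow> 'a::real_normed_vector"
  assumes "l > 0"
    and F: "\<And>x t. x \<in> {0..l} \<Longrightarrow> t \<in> S \<Longrightarrow>
      ((\<lambda>\<xi>. F \<xi> t) has_vector_derivative g x t) (at x within {0..l})"
    and F0: "\<And>t. t \<in> S \<Longrightarrow> F 0 t = c"
    and h: "\<And>x. x \<in> {0..l} \<Longrightarrow> (h has_vector_derivative k x) (at x within {0..l})" and h0: "h 0 = 0"
    and lin: "\<And>e. e > 0 \<Longrightarrow> \<exists>d>0. \<forall>t\<in>S. \<bar>t - t0\<bar> < d \<longrightarrow>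
      (\<forall>x\<in>{0..l}. norm (g x t - g x t0 - (t - t0) *\<^sub>R k x) \<le> e * \<bar>t - t0\<bar>)"
    and "x \<in> {0..l}" "t0 \<in> S"
  shows "((\<lambda>t. F x t) has_vector_derivative h x) (at t0 within S)"
  unfolding has_vector_derivative_def has_derivative_within_alt
proof (intro conjI allI impI bounded_linear_scaleR_left)
  fix e :: real assume "e > 0"
  \<comment> \<open>The mean value inequality over an x-interval of length at most \<open>l\<close>
    will multiply this tolerance by at most \<open>l\<close>.\<close>
  with \<open>l > 0\<close> have "e / l > 0" by simp
  from lin[OF this] obtain d where "d > 0" and d: "\<And>t \<xi>. t \<in> S \<Longrightarrow> \<bar>t - t0\<bar> < d \<Longrightarrow> \<xi> \<in> {0..l} \<Longrightarrow>
      norm (g \<xi> t - g \<xi> t0 - (t - t0) *\<^sub>R k \<xi>) \<le> e / l * \<bar>t - t0\<bar>" by blast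
  have "norm (F x t - F x t0 - (t - t0) *\<^sub>R h x) \<le> e * norm (t - t0)"
    if t: "t \<in> S" "\<bar>t - t0\<bar> < d" for t
  proof -
    define \<phi> where "\<phi> \<xi> = F \<xi> t - F \<xi> t0 - (t - t0) *\<^sub>R h \<xi>" for \<xi>
    have "(\<phi> has_vector_derivative g \<xi> t - g \<xi> t0 - (t - t0) *\<^sub>R k \<xi>) (at \<xi> within {0..l})"
      if "\<xi> \<in> {0..l}" for \<xi>
      unfolding \<phi>_def using that t \<open>t0 \<in> S\<close>
      by (auto intro!: derivative_eq_intros F h simp: algebra_simps)
    then have "norm (\<phi> x - \<phi> 0) \<le> e / l * \<bar>t - t0\<bar> * \<bar>x - 0\<bar>"
      using \<open>x \<in> {0..l}\<close> d[OF t] by (intro has_vector_derivative_imp_bound[of "{0..l}"]) auto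
    also have "\<dots> \<le> e / l * \<bar>t - t0\<bar> * l"
      using \<open>x \<in> {0..l}\<close> \<open>e > 0\<close> \<open>l > 0\<close> by (intro mult_left_mono) auto
    finally show ?thesis using F0 t \<open>t0 \<in> S\<close> h0 \<open>l > 0\<close> by (simp add: \<phi>_def)
  qed
  with \<open>d > 0\<close> show "\<exists>d>0. \<forall>t\<in>S. norm (t - t0) < d \<longrightarrow>
      norm (F x t - F x t0 - (t - t0) *\<^sub>R h x) \<le> e * norm (t - t0)" by auto
qed

text \<open>Supplies the last analytic hypothesis of \<open>has_vector_derivative_parameter\<close>.
  On the compact rectangle \<open>gt\<close> is uniformly continuous, so the mean value inequality
  bounds the remainder of the linearization in t uniformly in x.\<close>

lemma uniform_linearization:
  fixes g :: "real \<times> real \<Rightarrow> 'a::real_normed_vector"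
  assumes g: "\<And>x t. x \<in> {0..l} \<Longrightarrow> t \<in> {0..T} \<Longrightarrow>
      ((\<lambda>\<tau>. g (x, \<tau>)) has_vector_derivative gt (x, t)) (at t within {0..T})"
    and cont: "continuous_on (rect l T) gt" and "t0 \<in> {0..T}" "e > 0"
  shows "\<exists>d>0. \<forall>t\<in>{0..T}. \<bar>t - t0\<bar> < d \<longrightarrow>
      (\<forall>x\<in>{0..l}. norm (g (x, t) - g (x, t0) - (t - t0) *\<^sub>R gt (x, t0)) \<le> e * \<bar>t - t0\<bar>)"
proof -
  have "compact (rect l T)" by (simp add: rect_def compact_Times)
  then have "uniformly_continuous_on (rect l T) gt" using compact_uniformly_continuous cont by blast
  then obtain d where "d > 0"
    and d: "\<And>p q. p \<in> rect l T \<Longrightarrow> q \<in> rect l T \<Longrightarrow> dist p q < d \<Longrightarrow> dist (gt p) (gt q) < e"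
    using \<open>e > 0\<close> unfolding uniformly_continuous_on_def by metis
  have "norm (g (x, t) - g (x, t0) - (t - t0) *\<^sub>R gt (x, t0)) \<le> e * \<bar>t - t0\<bar>"
    if "t \<in> {0..T}" "\<bar>t - t0\<bar> < d" "x \<in> {0..l}" for x t
  proof -
    define \<phi> where "\<phi> \<tau> = g (x, \<tau>) - (\<tau> - t0) *\<^sub>R gt (x, t0)" for \<tau>
    \<comment> \<open>On this set \<open>gt (x, \<tau>)\<close> stays within \<open>e\<close> of
      \<open>gt (x, t0)\<close>, and it is convex, so the mean value inequality applies between
      \<open>t0\<close> and \<open>t\<close>.\<close>
    let ?S = "{0..T} \<inter> ball t0 d"
    have "(\<phi> has_vector_derivative gt (x, \<tau>) - gt (x, t0)) (at \<tau> within ?S)" if "\<tau> \<in> ?S" for \<tau>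
      unfolding \<phi>_def using that \<open>x \<in> _\<close>
      by (auto intro!: derivative_eq_intros has_vector_derivative_within_subset[OF g])
    moreover have "norm (gt (x, \<tau>) - gt (x, t0)) \<le> e" if "\<tau> \<in> ?S" for \<tau>
      using d[of "(x, \<tau>)" "(x, t0)"] that \<open>x \<in> _\<close> \<open>t0 \<in> _\<close>
      by (auto simp: rect_def dist_norm dist_Pair_Pair abs_minus_commute)
    ultimately have "norm (\<phi> t - \<phi> t0) \<le> e * \<bar>t - t0\<bar>"
      using that \<open>t0 \<in> _\<close> \<open>d > 0\<close>
      by (intro has_vector_derivative_imp_bound[of ?S]) (auto simp: dist_real_def convex_Int)
    then show ?thesis by (simp add: \<phi>_def algebra_simps)
  qed
  with \<open>d > 0\<close> show ?thesis by blast
qed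

text \<open>Symmetry of second derivatives, including one-sided ones at the boundary.
  Differentiating the increment of \<open>f\<close> from \<open>0\<close> to \<open>u\<close> under
  the integral sign gives \<open>?ft (u, t)\<close> as \<open>?ft (0, t)\<close> plus a primitive of
  \<open>?fxt\<close>; differentiating this in the space variable gives the claim.\<close>

lemma partial_t_partial_x:
  fixes f :: "real \<times> real \<Rightarrow> 'a::euclidean_space"
  assumes pos: "l > 0" "T > 0" and f: "Ck_on (Suc (Suc k)) (rect l T) f" and "x \<in> {0..l}" "t \<in> {0..T}"
  shows "partial_t T (partial_x l f) (x, t) = partial_x l (partial_t T f) (x, t)"
proof -
  let ?fx = "partial_x l f" and ?ft = "partial_t T f"
  let ?fxt = "partial_t T ?fx"
  note f' = Ck_on_rect_partials[OF pos f]
  note fx = Ck_on_rect_partials[OF pos f'(1)] and ft = Ck_on_rect_partials[OF pos f'(2)]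
  have cont: "continuous_on (rect l T) ?fxt" using fx(2) Ck_on_imp_continuous_on by blast
  then have "continuous_on {0..l} (\<lambda>\<xi>. ?fxt (\<xi>, t))"
    by (rule continuous_on_compose2) (use \<open>t \<in> _\<close> in \<open>auto simp: rect_def intro!: continuous_intros\<close>)
  define h where "h u = integral {0..u} (\<lambda>\<xi>. ?fxt (\<xi>, t))" for u
  have h: "(h has_vector_derivative ?fxt (u, t)) (at u within {0..l})" if "u \<in> {0..l}" for u
    unfolding h_def by (rule integral_has_vector_derivative) fact+
  have "?ft (u, t) = ?ft (0, t) + h u" if u: "u \<in> {0..l}" for u
  proof -
    \<comment> \<open>Subtracting \<open>f (0, \<tau>)\<close> makes the value at x = 0 independent
      of the parameter.\<close>
    have d1: "((\<lambda>\<tau>. f (u, \<tau>) - f (0, \<tau>)) has_vector_derivative h u) (at t within {0..T})"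
    proof (rule has_vector_derivative_parameter[OF pos(1)])
      show "((\<lambda>\<xi>. f (\<xi>, \<tau>) - f (0, \<tau>)) has_vector_derivative ?fx (x, \<tau>)) (at x within {0..l})"
        if "x \<in> {0..l}" "\<tau> \<in> {0..T}" for x \<tau>
        using f'(3)[OF that] by (auto intro!: derivative_eq_intros)
      show "\<exists>d>0. \<forall>\<tau>\<in>{0..T}. \<bar>\<tau> - t\<bar> < d \<longrightarrow> (\<forall>x\<in>{0..l}.
          norm (?fx (x, \<tau>) - ?fx (x, t) - (\<tau> - t) *\<^sub>R ?fxt (x, t)) \<le> e * \<bar>\<tau> - t\<bar>)"
        if "e > 0" for e
        by (rule uniform_linearization) (use fx(4) cont that \<open>t \<in> _\<close> in auto)
    qed (use h u \<open>t \<in> _\<close> in \<open>auto simp: h_def[of 0]\<close>)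
    have d2: "((\<lambda>\<tau>. f (u, \<tau>) - f (0, \<tau>)) has_vector_derivative ?ft (u, t) - ?ft (0, t))
        (at t within {0..T})"
      using f'(4)[of u t] f'(4)[of 0 t] u \<open>t \<in> _\<close> pos by (auto intro!: derivative_eq_intros)
    have "?ft (u, t) - ?ft (0, t) = h u"
      using vector_derivative_within_closed_interval[OF pos(2) \<open>t \<in> _\<close> d1]
        vector_derivative_within_closed_interval[OF pos(2) \<open>t \<in> _\<close> d2] by simp
    then show ?thesis by (simp add: algebra_simps)
  qed
  moreover have "((\<lambda>\<xi>. ?ft (0, t) + h \<xi>) has_vector_derivative ?fxt (x, t)) (at x within {0..l})"
    using has_vector_derivative_add[OF has_vector_derivative_const h[OF \<open>x \<in> _\<close>]] by simp
  ultimately have "((\<lambda>\<xi>. ?ft (\<xi>, t)) has_vector_derivative ?fxt (x, t)) (at x within {0..l})"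
    by (rule has_vector_derivative_transform[OF \<open>x \<in> _\<close>])
  then show ?thesis by (rule partial_x_eqI[OF pos(1) \<open>x \<in> _\<close>, symmetric])
qed

section \<open>Linear ordinary differential equations\<close>

text \<open>Induction step for the factorial bound: the asserted majorant vanishes at
  \<open>0\<close>, and its derivative is the majorant of \<open>u'\<close>, so the general mean
  value inequality compares the two.\<close>

lemma Picard_iterates_bound:
  fixes u :: "real \<Rightarrow> 'a::real_normed_vector"
  assumes u: "\<And>x. x \<in> {0..l} \<Longrightarrow> (u has_vector_derivative u' x) (at x within {0..l})" and "u 0 = 0"
    and b: "\<And>x. x \<in> {0..l} \<Longrightarrow> norm (u' x) \<le> c * (M * x) ^ n / fact n * M" and x: "x \<in> {0..l}"
  shows "norm (u x) \<le> c * (M * x) ^ Suc n / fact (Suc n)"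
proof (cases "x = 0")
  case False
  define \<phi> where "\<phi> \<xi> = c * (M * \<xi>) ^ Suc n / fact (Suc n)" for \<xi>
  have \<phi>: "(\<phi> has_real_derivative c * (M * \<xi>) ^ n / fact n * M) (at \<xi>)" for \<xi>
    unfolding \<phi>_def
    by (rule derivative_eq_intros refl | simp)+
  have "norm (u x - u 0) \<le> \<phi> x - \<phi> 0"
  proof (rule differentiable_bound_general)
    show "0 < x" using False x by simp
    show "continuous_on {0..x} u"
      by (rule continuous_on_subset[of "{0..l}"])
         (use x in \<open>auto intro!: continuous_on_vector_derivative[OF u]\<close>)
    show "continuous_on {0..x} \<phi>" unfolding \<phi>_def by (intro continuous_intros) auto
    fix \<xi> assume \<xi>: "0 < \<xi>" "\<xi> < x"
    then show "(u has_vector_derivative u' \<xi>) (at \<xi>)"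
      using u[of \<xi>] x by (auto simp: at_within_Icc_at)
    show "(\<phi> has_vector_derivative c * (M * \<xi>) ^ n / fact n * M) (at \<xi>)"
      using \<phi> by (simp add: has_real_derivative_iff_has_vector_derivative)
    show "norm (u' \<xi>) \<le> c * (M * \<xi>) ^ n / fact n * M" using b \<xi> x by simp
  qed
  then show ?thesis using \<open>u 0 = 0\<close> by (simp add: \<phi>_def)
qed (use \<open>u 0 = 0\<close> in simp)

text \<open>The Picard series of iterated integrals is dominated by an exponential series on the
  whole interval, since the equation is linear. It can therefore be summed and differentiated term
  by term.\<close>

proposition linear_ode_exists:
  fixes B :: "'a::banach \<Rightarrow> 'b::real_normed_vector \<Rightarrow> 'a"
  assumes B: "bounded_bilinear B" and A: "continuous_on {0..l} A" and "l > 0"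
  obtains Y where "Y 0 = c"
    and "\<And>x. x \<in> {0..l} \<Longrightarrow> (Y has_vector_derivative B (Y x) (A x)) (at x within {0..l})"
proof -
  interpret bounded_bilinear B by fact
  obtain K where "K > 0" and K: "\<And>u a. norm (B u a) \<le> norm u * norm a * K" using pos_bounded by blast
  have "bounded (A ` {0..l})" using A by (simp add: compact_continuous_image compact_imp_bounded)
  then obtain M0 where "M0 > 0" and M0: "\<And>x. x \<in> {0..l} \<Longrightarrow> norm (A x) \<le> M0"
    unfolding bounded_pos by blast
  define M where "M = M0 * K"
  have "M > 0" using \<open>M0 > 0\<close> \<open>K > 0\<close> by (simp add: M_def)
  have BM: "norm (B u (A x)) \<le> norm u * M" if "x \<in> {0..l}" for u x
    using K[of u "A x"] mult_right_mono[OF mult_left_mono[OF M0[OF that] norm_ge_zero[of u]], of K] \<open>K > 0\<close>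
    by (simp add: M_def mult.assoc)
  \<comment> \<open>These are the increments between successive Picard approximations, not the
    approximations themselves; the solution is their sum.\<close>
  define y where "y n = ((\<lambda>u x. integral {0..x} (\<lambda>\<xi>. B (u \<xi>) (A \<xi>))) ^^ n) (\<lambda>x. c)" for n
  have y0: "y 0 = (\<lambda>x. c)" and ySuc: "y (Suc n) = (\<lambda>x. integral {0..x} (\<lambda>\<xi>. B (y n \<xi>) (A \<xi>)))" for n
    by (simp_all add: y_def)
  \<comment> \<open>The first increment is the constant \<open>c\<close>, hence the value 0 for
    index 0.\<close>
  define y' where "y' n x = (case n of 0 \<Rightarrow> 0 | Suc m \<Rightarrow> B (y m x) (A x))" for n x
  have deriv: "\<forall>x\<in>{0..l}. (y n has_vector_derivative y' n x) (at x within {0..l})" for n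
  proof (induction n)
    case 0
    then show ?case by (simp add: y0 y'_def)
  next
    case (Suc n)
    then have "continuous_on {0..l} (\<lambda>\<xi>. B (y n \<xi>) (A \<xi>))"
      by (intro continuous_on A) (blast intro: continuous_on_vector_derivative)
    then show ?case unfolding ySuc y'_def nat.case by (blast intro: integral_has_vector_derivative)
  qed
  have bound: "\<forall>x\<in>{0..l}. norm (y n x) \<le> norm c * (M * x) ^ n / fact n" for n
  proof (induction n)
    case 0
    then show ?case by (simp add: y0)
  next
    case (Suc n)
    show ?case
    proof
      fix x assume x: "x \<in> {0..l}"
      show "norm (y (Suc n) x) \<le> norm c * (M * x) ^ Suc n / fact (Suc n)"
      proof (rule Picard_iterates_bound[OF _ _ _ x])
        show "norm (y' (Suc n) \<xi>) \<le> norm c * (M * \<xi>) ^ n / fact n * M" if "\<xi> \<in> {0..l}" for \<xi>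
          using order_trans[OF BM[OF that] mult_right_mono[OF bspec[OF Suc that]]] \<open>M > 0\<close>
          by (simp add: y'_def)
        show "(y (Suc n) has_vector_derivative y' (Suc n) \<xi>) (at \<xi> within {0..l})" if "\<xi> \<in> {0..l}" for \<xi>
          using deriv that by blast
      qed (simp add: ySuc)
    qed
  qed
  have bound': "norm (y n x) \<le> norm c * ((M * l) ^ n / fact n)" if "x \<in> {0..l}" for n x
  proof -
    have "norm c * (M * x) ^ n / fact n \<le> norm c * (M * l) ^ n / fact n"
      using that \<open>M > 0\<close> by (intro divide_right_mono mult_left_mono power_mono) auto
    with bspec[OF bound that] show ?thesis unfolding times_divide_eq_right by (rule order_trans)
  qed
  have "summable (\<lambda>n. norm c * ((M * l) ^ n / fact n))"
    using summable_exp[of "M * l"] by (intro summable_mult) (simp add: divide_inverse mult.commute)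
  then have lim: "uniform_limit {0..l} (\<lambda>n x. \<Sum>i<n. y i x) (\<lambda>x. suminf (\<lambda>i. y i x)) sequentially"
    using bound' by (intro Weierstrass_m_test) auto
  define Y where "Y x = suminf (\<lambda>i. y i x)" for x
  have sums: "(\<lambda>n. y n x) sums Y x" if "x \<in> {0..l}" for x
    using tendsto_uniform_limitI[OF lim that] by (simp add: sums_def Y_def)
  \<comment> \<open>Termwise differentiation yields some sum \<open>g\<close> whose derivative is
    expressed through \<open>Y\<close>; uniqueness of sums identifies the two afterwards.\<close>
  have "\<exists>g. \<forall>x\<in>{0..l}. (\<lambda>n. y n x) sums g x \<and>
      (g has_derivative (\<lambda>h. h *\<^sub>R B (Y x) (A x))) (at x within {0..l})"
  proof (rule has_derivative_series)
    show "(y n has_derivative (\<lambda>h. h *\<^sub>R y' n x)) (at x within {0..l})" if "x \<in> {0..l}" for n x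
      using deriv that by (simp add: has_vector_derivative_def)
    show "0 \<in> {0..l}" "(\<lambda>n. y n 0) sums Y 0" using \<open>l > 0\<close> sums by auto
    fix e :: real assume "e > 0"
    then have "\<forall>\<^sub>F n in sequentially. \<forall>x\<in>{0..l}. dist (\<Sum>i<n. y i x) (Y x) < e / M"
      using uniform_limitD[OF lim, of "e / M"] \<open>M > 0\<close> by (simp add: Y_def)
    then have "\<forall>\<^sub>F n in sequentially. \<forall>x\<in>{0..l}. \<forall>h.
        norm ((\<Sum>i<Suc n. h *\<^sub>R y' i x) - h *\<^sub>R B (Y x) (A x)) \<le> e * norm h"
    proof (rule eventually_mono, intro ballI allI)
      fix n x and h :: real
      assume n: "\<forall>x\<in>{0..l}. dist (\<Sum>i<n. y i x) (Y x) < e / M" and x: "x \<in> {0..l}"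
      \<comment> \<open>As \<open>y' 0\<close> vanishes, the first \<open>Suc n\<close> derivatives
        involve exactly the first \<open>n\<close> terms. The shift of index is undone at the end
        with \<open>eventually_sequentially_Suc\<close>.\<close>
      have "(\<Sum>i<Suc n. h *\<^sub>R y' i x) = h *\<^sub>R B (\<Sum>i<n. y i x) (A x)"
        by (simp add: sum.lessThan_Suc_shift y'_def sum_left scaleR_sum_right del: sum.lessThan_Suc)
      then have "norm ((\<Sum>i<Suc n. h *\<^sub>R y' i x) - h *\<^sub>R B (Y x) (A x)) =
          \<bar>h\<bar> * norm (B ((\<Sum>i<n. y i x) - Y x) (A x))"
        by (simp add: diff_left flip: scaleR_diff_right del: sum.lessThan_Suc)
      also have "\<dots> \<le> \<bar>h\<bar> * (norm ((\<Sum>i<n. y i x) - Y x) * M)"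
        using BM[OF x] by (intro mult_left_mono) auto
      also have "\<dots> \<le> \<bar>h\<bar> * e"
        using bspec[OF n x] \<open>M > 0\<close> by (intro mult_left_mono) (auto simp: dist_norm field_simps)
      finally show "norm ((\<Sum>i<Suc n. h *\<^sub>R y' i x) - h *\<^sub>R B (Y x) (A x)) \<le> e * norm h"
        by (simp add: mult.commute)
    qed
    then show "\<forall>\<^sub>F n in sequentially. \<forall>x\<in>{0..l}. \<forall>h.
        norm ((\<Sum>i<n. h *\<^sub>R y' i x) - h *\<^sub>R B (Y x) (A x)) \<le> e * norm h"
      by (subst (asm) eventually_sequentially_Suc)
  qed simp
  then obtain g where g: "\<And>x. x \<in> {0..l} \<Longrightarrow> (\<lambda>n. y n x) sums g x"
    and g': "\<And>x. x \<in> {0..l} \<Longrightarrow> (g has_vector_derivative B (Y x) (A x)) (at x within {0..l})"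
    unfolding has_vector_derivative_def by blast
  have "g x = Y x" if "x \<in> {0..l}" for x using g[OF that] sums[OF that] sums_unique2 by blast
  \<comment> \<open>All later terms are integrals over a degenerate interval, so only the first
    contributes to the initial value.\<close>
  moreover have "y n 0 = (if n = 0 then c else 0)" for n by (cases n) (simp_all add: y0 ySuc)
  then have "Y 0 = c" using sums_single[of 0 "\<lambda>n. c"] by (simp add: Y_def sums_iff)
  ultimately show thesis using that[of g] g' \<open>l > 0\<close> by auto
qed

section \<open>Derivatives on compact intervals and continuity up to the boundary\<close>

lemma has_vector_derivative_unique_Icc:
  fixes f :: "real \<Rightarrow> 'a::euclidean_space"
  assumes "a < b" "x \<in> {a..b}" "(f has_vector_derivative d) (at x within {a..b})"
    and "(f has_vector_derivative d') (at x within {a..b})"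
  shows "d = d'"
  using vector_derivative_within_closed_interval[OF assms(1-3)]
    vector_derivative_within_closed_interval[OF assms(1,2,4)] by simp

lemma has_vector_derivative_zero_imp_eq:
  fixes f :: "real \<Rightarrow> 'a::real_normed_vector"
  assumes "\<And>x. x \<in> {0..l} \<Longrightarrow> (f has_vector_derivative 0) (at x within {0..l})" and "x \<in> {0..l}"
  shows "f x = f 0"
  using has_vector_derivative_imp_bound[of "{0..l}" f "\<lambda>x. 0" 0 x 0] assms by simp

lemma Ck_on_Icc_derivative:
  fixes f :: "real \<Rightarrow> 'a::euclidean_space"
  assumes "a < b" and f: "Ck_on (Suc k) {a..b} f"
  shows Ck_on_vector_derivative: "Ck_on k {a..b} (\<lambda>x. vector_derivative f (at x within {a..b}))"
    and Ck_on_has_vector_derivative: "\<And>x. x \<in> {a..b} \<Longrightarrow>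
      (f has_vector_derivative vector_derivative f (at x within {a..b})) (at x within {a..b})"
proof -
  from f obtain D where D: "\<And>x. x \<in> {a..b} \<Longrightarrow> (f has_derivative D x) (at x within {a..b})"
    and C: "\<And>h. Ck_on k {a..b} (\<lambda>x. D x h)" by (rule Ck_on_SucE) blast
  have D': "(f has_vector_derivative D x 1) (at x within {a..b})" if "x \<in> {a..b}" for x
  proof -
    have "D x = (\<lambda>h. h *\<^sub>R D x 1)"
    proof
      show "D x h = h *\<^sub>R D x 1" for h
        using linear_scale[OF has_derivative_linear[OF D[OF that]], of h 1] by simp
    qed
    with D[OF that] show ?thesis unfolding has_vector_derivative_def by (rule back_subst)
  qed
  have eq: "vector_derivative f (at x within {a..b}) = D x 1" if "x \<in> {a..b}" for x
    using vector_derivative_within_closed_interval[OF \<open>a < b\<close> that D'[OF that]] .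
  show "Ck_on k {a..b} (\<lambda>x. vector_derivative f (at x within {a..b}))"
    by (rule Ck_on_cong[THEN iffD2, OF eq C])
  show "(f has_vector_derivative vector_derivative f (at x within {a..b})) (at x within {a..b})"
    if "x \<in> {a..b}" for x
    using D'[OF that] by (simp only: eq[OF that])
qed

text \<open>The map is Lipschitz along both sides of an L-shaped path between two points. This
  starts the regularity argument for the rotation field, whose partial derivatives contain the field
  itself and are at first only known to be bounded.\<close>

lemma continuous_on_rect_if_bounded_partials:
  fixes f :: "real \<times> real \<Rightarrow> 'a::real_normed_vector"
  assumes fx: "\<And>x t. x \<in> {0..l} \<Longrightarrow> t \<in> {0..T} \<Longrightarrow>
      ((\<lambda>\<xi>. f (\<xi>, t)) has_vector_derivative fx (x, t)) (at x within {0..l})"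
    and ft: "\<And>x t. x \<in> {0..l} \<Longrightarrow> t \<in> {0..T} \<Longrightarrow>
      ((\<lambda>\<tau>. f (x, \<tau>)) has_vector_derivative ft (x, t)) (at t within {0..T})"
    and bx: "\<And>q. q \<in> rect l T \<Longrightarrow> norm (fx q) \<le> B" and bt: "\<And>q. q \<in> rect l T \<Longrightarrow> norm (ft q) \<le> B'"
  shows "continuous_on (rect l T) f"
  unfolding continuous_on_iff
proof (intro ballI allI impI)
  fix q and e :: real assume q: "q \<in> rect l T" and "e > 0"
  obtain x t where qxt: "q = (x, t)" "x \<in> {0..l}" "t \<in> {0..T}" using q unfolding rect_def by blast
  \<comment> \<open>The summand 1 makes \<open>M\<close> positive, so that \<open>e / M\<close> can
    serve as the radius.\<close>
  define M where "M = B + B' + 1"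
  have B: "B \<ge> 0" "B' \<ge> 0" using bx[OF q] bt[OF q] norm_ge_zero order_trans by blast+
  then have "M > 0" by (simp add: M_def)
  have "dist (f q') (f q) < e" if q': "q' \<in> rect l T" "dist q' q < e / M" for q'
  proof -
    obtain x' t' where x't': "q' = (x', t')" "x' \<in> {0..l}" "t' \<in> {0..T}" using q' unfolding rect_def by blast
    have d: "\<bar>x' - x\<bar> \<le> dist q' q" "\<bar>t' - t\<bar> \<le> dist q' q"
      using dist_fst_le[of q' q] dist_snd_le[of q' q] by (auto simp: x't' qxt dist_real_def)
    have "norm (f (x', t') - f (x, t')) \<le> B * \<bar>x' - x\<bar>"
      by (rule has_vector_derivative_imp_bound[OF _ fx bx]) (use x't' qxt in \<open>auto simp: rect_def\<close>)
    also have "\<dots> \<le> B * dist q' q" using B d by (intro mult_left_mono)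
    finally have 1: "norm (f (x', t') - f (x, t')) \<le> B * dist q' q" .
    have "norm (f (x, t') - f (x, t)) \<le> B' * \<bar>t' - t\<bar>"
      by (rule has_vector_derivative_imp_bound[OF _ ft bt]) (use x't' qxt in \<open>auto simp: rect_def\<close>)
    also have "\<dots> \<le> B' * dist q' q" using B d by (intro mult_left_mono)
    finally have "norm (f q' - f q) \<le> B * dist q' q + B' * dist q' q"
      using 1 norm_triangle_le[of "f (x', t') - f (x, t')" "f (x, t') - f (x, t)"] by (simp add: qxt x't')
    also have "\<dots> \<le> M * dist q' q" by (simp add: M_def algebra_simps)
    also have "\<dots> < e" using q' \<open>M > 0\<close> by (simp add: field_simps)
    finally show ?thesis by (simp add: dist_norm)
  qed
  then show "\<exists>d>0. \<forall>q'\<in>rect l T. dist q' q < d \<longrightarrow> dist (f q') (f q) < e"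
    using \<open>M > 0\<close> \<open>e > 0\<close> by (intro exI[of _ "e / M"]) auto
qed

text \<open>The open rectangle is dense. This carries the balance laws, imposed in the interior, to
  the boundary.\<close>

lemma continuous_on_rect_eq:
  fixes f g :: "real \<times> real \<Rightarrow> 'a::real_normed_vector"
  assumes "l > 0" "T > 0" "continuous_on (rect l T) f" "continuous_on (rect l T) g"
    and eq: "\<And>x t. x \<in> {0<..<l} \<Longrightarrow> t \<in> {0<..<T} \<Longrightarrow> f (x, t) = g (x, t)" and "q \<in> rect l T"
  shows "f q = g q"
proof -
  have cl: "closure ({0<..<l} \<times> {0<..<T}) = rect l T"
    using assms by (simp add: closure_Times rect_def)
  have "f q - g q = 0"
    by (rule continuous_constant_on_closure[of "{0<..<l} \<times> {0<..<T}" "\<lambda>q. f q - g q"])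
       (use assms cl in \<open>auto intro: continuous_on_diff\<close>)
  then show ?thesis by simp
qed

lemma continuous_on_Icc_eq:
  fixes f g :: "real \<Rightarrow> 'a::real_normed_vector"
  assumes "a < b" "continuous_on {a..b} f" "continuous_on {a..b} g"
    and eq: "\<And>x. x \<in> {a<..<b} \<Longrightarrow> f x = g x" and "x \<in> {a..b}"
  shows "f x = g x"
proof -
  have "f x - g x = 0"
    by (rule continuous_constant_on_closure[of "{a<..<b}" "\<lambda>q. f q - g q"])
       (use assms in \<open>auto intro: continuous_on_diff\<close>)
  then show ?thesis by simp
qed

section \<open>Rotation-valued functions and skew-symmetric linear equations\<close>

lemmas has_vector_derivative_matrix_mult =
  bounded_bilinear.has_vector_derivative[OF bounded_bilinear_matrix_mult]
lemmas has_vector_derivative_matrix_vector_mult =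
  bounded_bilinear.has_vector_derivative[OF bounded_bilinear_matrix_vector_mult]
lemmas has_vector_derivative_transpose =
  bounded_linear.has_vector_derivative[OF bounded_linear_transpose]

lemma rotation_matrixD:
  assumes "rotation_matrix (Q :: real^'n^'n)"
  shows "transpose Q ** Q = mat 1" "Q ** transpose Q = mat 1"
  using assms by (auto simp: rotation_matrix_def orthogonal_matrix_def)

text \<open>Differentiate the constant product Q^T Q = 1. This guarantees that
  \<open>vec_of_skew\<close> is only evaluated at skew-symmetric matrices.\<close>

lemma transpose_mult_derivative_skew:
  fixes Q :: "real \<Rightarrow> real^'n^'n"
  assumes "a < b" and Q: "\<And>x. x \<in> {a..b} \<Longrightarrow> rotation_matrix (Q x)" and x: "x \<in> {a..b}"
    and Q': "(Q has_vector_derivative Q') (at x within {a..b})"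
  shows "transpose (transpose (Q x) ** Q') = - (transpose (Q x) ** Q')"
proof -
  have "((\<lambda>x. transpose (Q x) ** Q x) has_vector_derivative transpose (Q x) ** Q' + transpose Q' ** Q x)
      (at x within {a..b})"
    by (intro has_vector_derivative_matrix_mult has_vector_derivative_transpose Q')
  moreover have "((\<lambda>x. transpose (Q x) ** Q x) has_vector_derivative 0) (at x within {a..b})"
    by (rule has_vector_derivative_transform[OF x, of _ "\<lambda>x. mat 1"])
       (use Q rotation_matrixD in \<open>auto simp: has_vector_derivative_const\<close>)
  ultimately have "transpose (Q x) ** Q' + transpose Q' ** Q x = 0"
    using has_vector_derivative_unique_Icc \<open>a < b\<close> x by blast
  then show ?thesis by (simp add: matrix_transpose_mul eq_neg_iff_add_eq_0 add.commute)
qed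

text \<open>Since \<open>A\<close> is skew, the two terms of the derivative of \<open>Q Q'\<^sup>T\<close> cancel.\<close>

lemma skew_ode_mult_transpose_const:
  fixes Q Q' A :: "real \<Rightarrow> real^'n^'n"
  assumes Q: "\<And>x. x \<in> {0..l} \<Longrightarrow> (Q has_vector_derivative Q x ** A x) (at x within {0..l})"
    and Q': "\<And>x. x \<in> {0..l} \<Longrightarrow> (Q' has_vector_derivative Q' x ** A x) (at x within {0..l})"
    and A: "\<And>x. x \<in> {0..l} \<Longrightarrow> transpose (A x) = - A x" and "x \<in> {0..l}"
  shows "Q x ** transpose (Q' x) = Q 0 ** transpose (Q' 0)"
proof (rule has_vector_derivative_zero_imp_eq[of l])
  fix x assume x: "x \<in> {0..l}"
  have "((\<lambda>x. Q x ** transpose (Q' x)) has_vector_derivative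
      Q x ** transpose (Q' x ** A x) + (Q x ** A x) ** transpose (Q' x)) (at x within {0..l})"
    by (intro has_vector_derivative_matrix_mult has_vector_derivative_transpose Q Q' x)
  moreover have "Q x ** transpose (Q' x ** A x) + (Q x ** A x) ** transpose (Q' x) = 0"
    by (simp add: matrix_transpose_mul A[OF x] matrix_mul_assoc
        bounded_bilinear.minus_left[OF bounded_bilinear_matrix_mult]
        bounded_bilinear.minus_right[OF bounded_bilinear_matrix_mult])
  ultimately show "((\<lambda>x. Q x ** transpose (Q' x)) has_vector_derivative 0) (at x within {0..l})" by simp
qed fact

text \<open>The constant product Q Q'^T is the identity at \<open>0\<close>; multiplying by the
  rotation \<open>Q' x\<close> gives equality at \<open>x\<close>.\<close>

lemma skew_ode_unique:
  fixes Q Q' A :: "real \<Rightarrow> real^'n^'n"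
  assumes Q: "\<And>x. x \<in> {0..l} \<Longrightarrow> (Q has_vector_derivative Q x ** A x) (at x within {0..l})"
    and Q': "\<And>x. x \<in> {0..l} \<Longrightarrow> (Q' has_vector_derivative Q' x ** A x) (at x within {0..l})"
    and A: "\<And>x. x \<in> {0..l} \<Longrightarrow> transpose (A x) = - A x" and x: "x \<in> {0..l}"
    and rot: "rotation_matrix (Q' x)" "rotation_matrix (Q' 0)" and "Q 0 = Q' 0"
  shows "Q x = Q' x"
proof -
  have "Q x ** transpose (Q' x) = mat 1"
    using skew_ode_mult_transpose_const[OF Q Q' A x] rotation_matrixD[OF rot(2)] \<open>Q 0 = Q' 0\<close> by simp
  then have "Q x ** transpose (Q' x) ** Q' x = Q' x" by simp
  then show ?thesis using rotation_matrixD[OF rot(1)] by (simp flip: matrix_mul_assoc)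
qed

text \<open>The constancy of the product, applied to \<open>Q\<close> paired with itself, preserves
  orthogonality. The determinant is then continuous with values in {1, -1}, hence constant on the
  interval and equal to its value 1 at \<open>0\<close>.\<close>

lemma skew_ode_rotation:
  fixes Q A :: "real \<Rightarrow> real^'n^'n"
  assumes Q: "\<And>x. x \<in> {0..l} \<Longrightarrow> (Q has_vector_derivative Q x ** A x) (at x within {0..l})"
    and A: "\<And>x. x \<in> {0..l} \<Longrightarrow> transpose (A x) = - A x" and Q0: "rotation_matrix (Q 0)"
    and x: "x \<in> {0..l}"
  shows "rotation_matrix (Q x)"
proof -
  have orth: "orthogonal_matrix (Q x)" if "x \<in> {0..l}" for x
    using skew_ode_mult_transpose_const[OF Q Q A that] rotation_matrixD[OF Q0]
    by (simp add: orthogonal_matrix_def matrix_left_right_inverse)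
  have "continuous_on {0..l} Q" by (rule continuous_on_vector_derivative) (rule Q)
  then have "continuous_on {0..l} (\<lambda>x. det (Q x))"
    unfolding det_def by (intro continuous_intros) auto
  then have "connected ((\<lambda>x. det (Q x)) ` {0..l})" by (intro connected_continuous_image) auto
  moreover have "(\<lambda>x. det (Q x)) ` {0..l} \<subseteq> {1, - 1}"
    using det_orthogonal_matrix[OF orth] by blast
  ultimately obtain c where c: "\<And>x. x \<in> {0..l} \<Longrightarrow> det (Q x) = c"
    using connected_finite_iff_sing finite_subset[of _ "{1, - 1::real}"] x
    by (metis (no_types, lifting) finite.emptyI finite.insertI image_eqI image_is_empty empty_iff singletonD)
  moreover have "0 \<in> {0..l}" using x by auto
  ultimately have "det (Q x) = 1" using Q0 x by (metis rotation_matrix_def)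
  then show ?thesis using orth[OF x] by (simp add: rotation_matrix_def)
qed

text \<open>The rows are unit vectors, and the norm is at most the sum of the row norms. This is an
  a priori bound that requires no continuity.\<close>

lemma norm_orthogonal_matrix_le:
  fixes Q :: "real^'n^'n"
  assumes "orthogonal_matrix Q"
  shows "norm Q \<le> CARD('n)"
proof -
  have "(Q ** transpose Q) $ i $ i = 1" for i
    using assms by (simp add: orthogonal_matrix_def mat_def)
  then have "norm (Q $ i) = 1" for i
    by (simp add: matrix_matrix_mult_def transpose_def norm_eq_1 inner_vec_def)
  then show ?thesis using L2_set_le_sum[of UNIV "\<lambda>i. norm (Q $ i)"] by (simp add: norm_vec_def)
qed

text \<open>Split F E = E + (F - 1) E. Both factors of the second term are of order t - t0, so it is
  quadratically small, uniformly in x. To first order the right-hand side is therefore (t - t0)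
  \<open>Et (x, t0)\<close>, whose primitive is \<open>h\<close>. A bound \<open>N\<close> on
  \<open>F\<close> takes the place of continuity in t, which is not yet known.\<close>

lemma linear_ode_parameter_derivative:
  fixes F E Et :: "real \<times> real \<Rightarrow> real^'n^'n" and h :: "real \<Rightarrow> real^'n^'n"
  assumes "l > 0" and t0: "t0 \<in> {0..T}"
    and F: "\<And>x t. x \<in> {0..l} \<Longrightarrow> t \<in> {0..T} \<Longrightarrow>
      ((\<lambda>\<xi>. F (\<xi>, t)) has_vector_derivative F (x, t) ** E (x, t)) (at x within {0..l})"
    and F0: "\<And>t. t \<in> {0..T} \<Longrightarrow> F (0, t) = mat 1" and Ft0: "\<And>x. x \<in> {0..l} \<Longrightarrow> F (x, t0) = mat 1"
    and N: "\<And>q. q \<in> rect l T \<Longrightarrow> norm (F q) \<le> N"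
    and E: "\<And>x t. x \<in> {0..l} \<Longrightarrow> t \<in> {0..T} \<Longrightarrow>
      ((\<lambda>\<tau>. E (x, \<tau>)) has_vector_derivative Et (x, t)) (at t within {0..T})"
    and Et: "continuous_on (rect l T) Et" and E0: "\<And>x. x \<in> {0..l} \<Longrightarrow> E (x, t0) = 0"
    and h: "\<And>x. x \<in> {0..l} \<Longrightarrow> (h has_vector_derivative Et (x, t0)) (at x within {0..l})" and "h 0 = 0"
    and x: "x \<in> {0..l}"
  shows "((\<lambda>t. F (x, t)) has_vector_derivative h x) (at t0 within {0..T})"
proof -
  interpret mm: bounded_bilinear "(**) :: real^'n^'n \<Rightarrow> real^'n^'n \<Rightarrow> real^'n^'n"
    by (rule bounded_bilinear_matrix_mult)
  obtain K where "K > 0" and K: "\<And>(A :: real^'n^'n) (B :: real^'n^'n). norm (A ** B) \<le> norm A * norm B * K"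
    using mm.pos_bounded by blast
  have "compact (rect l T)" by (simp add: rect_def compact_Times)
  then have "bounded (Et ` rect l T)" using Et by (simp add: compact_continuous_image compact_imp_bounded)
  then obtain M where "M > 0" and M: "\<And>q. q \<in> rect l T \<Longrightarrow> norm (Et q) \<le> M"
    unfolding bounded_pos by blast
  have "(0, t0) \<in> rect l T" using t0 \<open>l > 0\<close> by (simp add: rect_def)
  from N[OF this] have "N \<ge> 0" using norm_ge_zero order_trans by blast
  \<comment> \<open>\<open>E\<close> vanishes at \<open>t0\<close> and has a t-derivative bounded by
    \<open>M\<close>.\<close>
  have E_le: "norm (E (x, t)) \<le> M * \<bar>t - t0\<bar>" if "x \<in> {0..l}" "t \<in> {0..T}" for x t
    using has_vector_derivative_imp_bound[of "{0..T}" "\<lambda>t. E (x, t)" "\<lambda>t. Et (x, t)" M t t0]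
      E M that t0 E0 by (auto simp: rect_def)
  define L where "L = N * M * K * l"
  have "L \<ge> 0" using \<open>N \<ge> 0\<close> \<open>M > 0\<close> \<open>K > 0\<close> \<open>l > 0\<close> by (simp add: L_def)
  \<comment> \<open>\<open>F\<close> starts at the identity for x = 0, and its x-derivative inherits
    the smallness of \<open>E\<close>.\<close>
  have F_le: "norm (F (x, t) - mat 1) \<le> L * \<bar>t - t0\<bar>" if x: "x \<in> {0..l}" and t: "t \<in> {0..T}" for x t
  proof -
    have "norm (F (x, t) - F (0, t)) \<le> N * (M * \<bar>t - t0\<bar>) * K * \<bar>x - 0\<bar>"
    proof (rule has_vector_derivative_imp_bound[of "{0..l}"])
      fix \<xi> assume \<xi>: "\<xi> \<in> {0..l}"
      then show "((\<lambda>\<xi>. F (\<xi>, t)) has_vector_derivative F (\<xi>, t) ** E (\<xi>, t)) (at \<xi> within {0..l})"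
        using F t by blast
      have "norm (F (\<xi>, t)) * norm (E (\<xi>, t)) \<le> N * (M * \<bar>t - t0\<bar>)"
        using N[of "(\<xi>, t)"] E_le[OF \<xi> t] \<open>N \<ge> 0\<close> \<xi> t by (intro mult_mono) (auto simp: rect_def)
      then show "norm (F (\<xi>, t) ** E (\<xi>, t)) \<le> N * (M * \<bar>t - t0\<bar>) * K"
        using K[of "F (\<xi>, t)" "E (\<xi>, t)"] \<open>K > 0\<close>
        by (auto intro: order_trans mult_right_mono)
    qed (use x \<open>l > 0\<close> in auto)
    also have "\<dots> \<le> N * (M * \<bar>t - t0\<bar>) * K * l"
      using x \<open>N \<ge> 0\<close> \<open>M > 0\<close> \<open>K > 0\<close> by (intro mult_left_mono) auto
    finally show ?thesis using F0[OF t] by (simp add: L_def mult_ac)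
  qed
  show ?thesis
  proof (rule has_vector_derivative_parameter[where F = "\<lambda>x t. F (x, t)" and g = "\<lambda>x t. F (x, t) ** E (x, t)"])
    fix e :: real assume "e > 0"
    then have "e / 2 > 0" by simp
    from uniform_linearization[OF E Et t0 this] obtain d where "d > 0" and d: "\<And>t x. t \<in> {0..T} \<Longrightarrow>
        \<bar>t - t0\<bar> < d \<Longrightarrow> x \<in> {0..l} \<Longrightarrow>
        norm (E (x, t) - E (x, t0) - (t - t0) *\<^sub>R Et (x, t0)) \<le> e / 2 * \<bar>t - t0\<bar>" by blast
    \<comment> \<open>A positive constant dominating the coefficient of the quadratic remainder;
      within distance \<open>e / 2 / P\<close> of \<open>t0\<close> this remainder uses up at most
      half of \<open>e\<close>.\<close>
    define P where "P = L * M * K + 1"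
    have "P > 0" using \<open>L \<ge> 0\<close> \<open>M > 0\<close> \<open>K > 0\<close> by (simp add: P_def add_nonneg_pos)
    have "norm (F (x, t) ** E (x, t) - F (x, t0) ** E (x, t0) - (t - t0) *\<^sub>R Et (x, t0)) \<le> e * \<bar>t - t0\<bar>"
      if t: "t \<in> {0..T}" "\<bar>t - t0\<bar> < min d (e / 2 / P)" and x: "x \<in> {0..l}" for t x
    proof -
      let ?A = "(F (x, t) - mat 1) ** E (x, t)" and ?B = "E (x, t) - E (x, t0) - (t - t0) *\<^sub>R Et (x, t0)"
      have eq: "F (x, t) ** E (x, t) - F (x, t0) ** E (x, t0) - (t - t0) *\<^sub>R Et (x, t0) = ?A + ?B"
        using E0[OF x] by (simp add: mm.diff_left)
      have "norm ?A \<le> e / 2 * \<bar>t - t0\<bar>"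
      proof -
        have "norm (F (x, t) - mat 1) * norm (E (x, t)) \<le> (L * \<bar>t - t0\<bar>) * (M * \<bar>t - t0\<bar>)"
          using F_le[OF x t(1)] E_le[OF x t(1)] \<open>L \<ge> 0\<close> by (intro mult_mono) auto
        then have "norm ?A \<le> (L * \<bar>t - t0\<bar>) * (M * \<bar>t - t0\<bar>) * K"
          using K[of "F (x, t) - mat 1" "E (x, t)"] \<open>K > 0\<close>
          by (auto intro: order_trans mult_right_mono)
        also have "\<dots> = (L * M * K) * \<bar>t - t0\<bar> * \<bar>t - t0\<bar>" by simp
        also have "\<dots> \<le> P * (e / 2 / P) * \<bar>t - t0\<bar>"
          using t \<open>P > 0\<close> by (intro mult_right_mono mult_mono) (auto simp: P_def)
        finally show ?thesis using \<open>P > 0\<close> by simp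
      qed
      moreover have "norm ?B \<le> e / 2 * \<bar>t - t0\<bar>" using d t x by simp
      ultimately show ?thesis unfolding eq using norm_triangle_ineq[of ?A ?B] by linarith
    qed
    then show "\<exists>d>0. \<forall>t\<in>{0..T}. \<bar>t - t0\<bar> < d \<longrightarrow> (\<forall>x\<in>{0..l}.
        norm (F (x, t) ** E (x, t) - F (x, t0) ** E (x, t0) - (t - t0) *\<^sub>R Et (x, t0)) \<le> e * \<bar>t - t0\<bar>)"
      using \<open>d > 0\<close> \<open>P > 0\<close> \<open>e > 0\<close> by (intro exI[of _ "min d (e / 2 / P)"]) auto
  qed (use assms in auto)
qed

section \<open>Skew matrices and block vectors\<close>

text \<open>A linear left inverse of \<open>hat\<close>. It agrees with \<open>vec_of_skew\<close>
  on skew-symmetric matrices but is linear on all matrices, so the calculus of linear maps applies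
  to it.\<close>

definition vee :: "real^3^3 \<Rightarrow> real^3" where
  "vee M = vector [M $ 3 $ 2, M $ 1 $ 3, M $ 2 $ 1]"

lemma bounded_linear_vee: "bounded_linear vee"
  by (auto simp: linear_conv_bounded_linear[symmetric] vee_def vec_eq_iff forall_3 intro!: linearI)

lemma bounded_linear_hat: "bounded_linear hat"
  by (auto simp: linear_conv_bounded_linear[symmetric] hat_eq vec_eq_iff forall_3 intro!: linearI)

lemmas has_vector_derivative_hat = bounded_linear.has_vector_derivative[OF bounded_linear_hat]

lemma vee_hat [simp]: "vee (hat u) = u"
  by (simp add: vee_def hat_eq vec_eq_iff forall_3)

lemma transpose_hat: "transpose (hat u) = - hat u"
  by (simp add: transpose_def hat_eq vec_eq_iff forall_3)

lemma hat_vee: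
  assumes "transpose M = - M"
  shows "hat (vee M) = M"
proof -
  have skew: "M $ i $ j = - M $ j $ i" for i j
    using arg_cong[OF assms, of "\<lambda>N. N $ j $ i"] by (simp add: transpose_def)
  have "M $ i $ i = 0" for i using skew[of i i] by simp
  with skew[of 1 2] skew[of 3 1] skew[of 2 3] show ?thesis
    by (simp add: hat_eq vee_def vec_eq_iff forall_3)
qed

lemma vec_of_skew_eq_vee: "transpose M = - M \<Longrightarrow> vec_of_skew M = vee M"
  by (metis hat_vee vec_of_skew_hat)

text \<open>\<open>hat\<close> is a Lie algebra homomorphism. It turns the commutator arising from
  the mixed derivatives of the rotation into the cross product of the angular balance law.\<close>

lemma hat_commutator: "hat u ** hat w - hat w ** hat u = hat (cross3 u w)"
  by (simp add: hat_eq vec_eq_iff forall_3 matrix_matrix_mult_def sum_3 cross3_def algebra_simps)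

lemma bounded_linear_upper: "bounded_linear (upper :: real^('m::finite + 'n::finite) \<Rightarrow> real^'m)"
  and bounded_linear_lower: "bounded_linear (lower :: real^('m::finite + 'n::finite) \<Rightarrow> real^'n)"
  by (auto simp: linear_conv_bounded_linear[symmetric] upper_def lower_def vec_eq_iff intro!: linearI)

lemma bounded_linear_stack:
  "bounded_linear (\<lambda>p. stack (fst p) (snd p) :: real^('m::finite + 'n::finite))"
  by (auto simp: linear_conv_bounded_linear[symmetric] stack_def vec_eq_iff split: sum.split intro!: linearI)

lemma blockwise_eq_iff: "y = y' \<longleftrightarrow> upper y = upper y' \<and> lower y = lower y'"
  by (metis stack_upper_lower)

lemma Ck_on_stack:
  fixes u :: "'a::euclidean_space \<Rightarrow> real^'m::finite" and w :: "'a \<Rightarrow> real^'n::finite"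
  shows "Ck_on k S u \<Longrightarrow> Ck_on k S w \<Longrightarrow> Ck_on k S (\<lambda>x. stack (u x) (w x))"
  using Ck_on_linear[OF bounded_linear_stack Ck_on_Pair, of k S u w] by simp

lemmas Ck_on_upper = Ck_on_linear[OF bounded_linear_upper]
  and Ck_on_lower = Ck_on_linear[OF bounded_linear_lower]
  and Ck_on_hat = Ck_on_linear[OF bounded_linear_hat]
  and Ck_on_vee = Ck_on_linear[OF bounded_linear_vee]
  and Ck_on_transpose = Ck_on_linear[OF bounded_linear_transpose]
  and Ck_on_fst = Ck_on_linear[OF bounded_linear_fst]
  and Ck_on_snd = Ck_on_linear[OF bounded_linear_snd]
  and Ck_on_matrix_mult = Ck_on_bilinear[OF bounded_bilinear_matrix_mult]
  and Ck_on_matrix_vector_mult = Ck_on_bilinear[OF bounded_bilinear_matrix_vector_mult]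

text \<open>By antisymmetry of the cross product the curvature joins \<open>s2\<close> and the
  vector \<open>e\<close> joins \<open>s1\<close>, so only total strains remain.\<close>

lemma balance_eq_iff:
  "a - b - (cross3 \<Upsilon> v1 + cross3 e v2) = - cross3 v2 s1 - cross3 v1 s2 \<longleftrightarrow>
   a = b + cross3 (s2 + \<Upsilon>) v1 - cross3 v2 (s1 + e)"
proof -
  have "a - b - (cross3 \<Upsilon> v1 + cross3 e v2) - (- cross3 v2 s1 - cross3 v1 s2) =
      a - (b + cross3 (s2 + \<Upsilon>) v1 - cross3 v2 (s1 + e))"
    by (simp add: cross3_simps)
  then show ?thesis by (metis eq_iff_diff_eq_0)
qed

lemma rotation_mult_eq_iff:
  assumes "rotation_matrix (Q :: real^'n^'n)"
  shows "transpose Q *v a = b \<longleftrightarrow> a = Q *v b" "transpose Q ** M = N \<longleftrightarrow> M = Q ** N"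
  using rotation_matrixD[OF assms]
  by (metis matrix_vector_mul_assoc matrix_vector_mul_lid, metis matrix_mul_assoc matrix_mul_lid)

lemma rotation_cancel:
  assumes "rotation_matrix (Q :: real^'n^'n)"
  shows "Q *v a = Q *v b \<longleftrightarrow> a = b" "Q ** M = Q ** N \<longleftrightarrow> M = N"
  using rotation_mult_eq_iff[OF assms] by metis+

section \<open>The beam\<close>

locale beam =
  fixes T l :: real
    and C :: "real \<Rightarrow> real^(3 + 3)^(3 + 3)"
    and R :: "real \<Rightarrow> real^3^3"
    and fp :: "real^3" and fR :: "real^3^3"
    and p0 :: "real \<Rightarrow> real^3" and R0 :: "real \<Rightarrow> real^3^3"
  assumes T: "T > 0" and l: "l > 0"
    and C: "Ck_on 1 {0..l} C"
    and pos_def: "\<And>x w. x \<in> {0..l} \<Longrightarrow> w \<noteq> 0 \<Longrightarrow> w \<bullet> (C x *v w) > 0"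
    and R: "Ck_on 2 {0..l} R" "\<And>x. x \<in> {0..l} \<Longrightarrow> rotation_matrix (R x)"
    and initial: "Ck_on 2 {0..l} (\<lambda>x. (p0 x, R0 x))" "\<And>x. x \<in> {0..l} \<Longrightarrow> rotation_matrix (R0 x)"
    and f_eq: "(fp, fR) = (p0 0, R0 0)"
begin

text \<open>The unknown \<open>y\<close> enters only through the velocities \<open>v1\<close>, \<open>v2\<close> and the total strains
  \<open>s1 + e1\<close>, \<open>s2 + \<Upsilon>\<close>, in which the curvature no longer appears explicitly.\<close>

definition lin_vel :: "(real \<times> real \<Rightarrow> real^((3 + 3) + (3 + 3))) \<Rightarrow> real \<times> real \<Rightarrow> real^3" where
  "lin_vel y q = upper (upper (y q))"

definition ang_vel :: "(real \<times> real \<Rightarrow> real^((3 + 3) + (3 + 3))) \<Rightarrow> real \<times> real \<Rightarrow> real^3" where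
  "ang_vel y q = lower (upper (y q))"

definition lin_strain :: "(real \<times> real \<Rightarrow> real^((3 + 3) + (3 + 3))) \<Rightarrow> real \<times> real \<Rightarrow> real^3" where
  "lin_strain y q = upper (C (fst q) *v lower (y q)) + e1"

definition ang_strain :: "(real \<times> real \<Rightarrow> real^((3 + 3) + (3 + 3))) \<Rightarrow> real \<times> real \<Rightarrow> real^3" where
  "ang_strain y q = lower (C (fst q) *v lower (y q)) + curvature l R (fst q)"

section \<open>Regularity of the data and of the velocities and strains\<close>

lemma rotation_fR: "rotation_matrix fR"
  using initial(2)[of 0] f_eq l by simp

lemma invertible_C:
  assumes "x \<in> {0..l}"
  shows "invertible (C x)"
proof -
  have "w = 0" if "C x *v w = 0" for w
    using pos_def[OF assms, of w] that by fastforce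
  then show ?thesis using invertible_left_inverse matrix_left_invertible_ker by blast
qed

text \<open>R^T R' is skew-symmetric and of class C^1, so \<open>vec_of_skew\<close> can be replaced
  by the linear map \<open>vee\<close>.\<close>

lemma Ck_on_curvature: "Ck_on 1 {0..l} (curvature l R)"
proof -
  have R': "Ck_on (Suc 1) {0..l} R" using R(1) by (simp add: numeral_2_eq_2)
  note d = Ck_on_Icc_derivative[OF l R']
  have "curvature l R x = vee (transpose (R x) ** vector_derivative R (at x within {0..l}))"
    if "x \<in> {0..l}" for x
    unfolding curvature_def
    by (rule vec_of_skew_eq_vee transpose_mult_derivative_skew[OF l R(2) that d(2)[OF that]])+
  moreover have "Ck_on 1 {0..l} (\<lambda>x. vee (transpose (R x) ** vector_derivative R (at x within {0..l})))"
    by (intro Ck_on_vee Ck_on_matrix_mult Ck_on_transpose d(1) Ck_on_Suc_imp[OF R'])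
  ultimately show ?thesis by (rule Ck_on_cong[THEN iffD2])
qed

lemma Ck_on_rect_fst: "Ck_on k {0..l} f \<Longrightarrow> Ck_on k (rect l T) (\<lambda>q. f (fst q))"
  by (rule Ck_on_compose_linear[OF bounded_linear_fst]) (auto simp: rect_def)

lemma Ck_on_lin_vel: "Ck_on k (rect l T) y \<Longrightarrow> Ck_on k (rect l T) (lin_vel y)"
  and Ck_on_ang_vel: "Ck_on k (rect l T) y \<Longrightarrow> Ck_on k (rect l T) (ang_vel y)"
  unfolding lin_vel_def ang_vel_def by (intro Ck_on_upper Ck_on_lower, assumption)+

lemma Ck_on_lin_strain: "Ck_on 1 (rect l T) y \<Longrightarrow> Ck_on 1 (rect l T) (lin_strain y)"
  and Ck_on_ang_strain: "Ck_on 1 (rect l T) y \<Longrightarrow> Ck_on 1 (rect l T) (ang_strain y)"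
  unfolding lin_strain_def ang_strain_def
  by (intro Ck_on_add Ck_on_const Ck_on_upper Ck_on_lower Ck_on_matrix_vector_mult
      Ck_on_rect_fst C Ck_on_curvature, assumption)+

section \<open>Membership in the two function spaces, up to the boundary\<close>

text \<open>Continuity extends the boundary and initial conditions from the open intervals to the
  closed ones; in particular they become available at the corners.\<close>

lemma E1_iff:
  "P \<in> E1 l T fp fR p0 R0 \<longleftrightarrow> P \<in> extensional (rect l T) \<and> Ck_on 2 (rect l T) P \<and>
     (\<forall>q\<in>rect l T. rotation_matrix (snd (P q))) \<and>
     (\<forall>t\<in>{0..T}. P (0, t) = (fp, fR)) \<and> (\<forall>x\<in>{0..l}. P (x, 0) = (p0 x, R0 x))"
    (is "?L \<longleftrightarrow> ?R")
proof
  assume P: ?L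
  then have c: "continuous_on (rect l T) P" by (auto simp: E1_def intro: Ck_on_imp_continuous_on)
  have c': "continuous_on {0..T} (\<lambda>t. P (0, t))" "continuous_on {0..l} (\<lambda>x. P (x, 0))"
    using T l by (auto intro!: continuous_on_compose2[OF c] continuous_intros simp: rect_def)
  have "P (0, t) = (fp, fR)" if "t \<in> {0..T}" for t
    by (rule continuous_on_Icc_eq[OF T c'(1) continuous_on_const _ that])
       (use P in \<open>auto simp: E1_def\<close>)
  moreover have "P (x, 0) = (p0 x, R0 x)" if "x \<in> {0..l}" for x
    by (rule continuous_on_Icc_eq[OF l c'(2) Ck_on_imp_continuous_on[OF initial(1)] _ that])
       (use P in \<open>auto simp: E1_def\<close>)
  ultimately show ?R using P by (simp add: E1_def)
qed (auto simp: E1_def)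

text \<open>The vector e1 and the curvature do not depend on t, so strains and total strains have
  the same t-derivative. The block equation is then read off row by row.\<close>

lemma balance_laws_iff:
  assumes y: "Ck_on 1 (rect l T) y" and x: "x \<in> {0..l}" and t: "t \<in> {0..T}"
  shows "partial_t T (\<lambda>(x, t). C x *v lower (y (x, t))) (x, t) - partial_x l (\<lambda>q. upper (y q)) (x, t)
         - block_matrix (hat (curvature l R x)) (hat e1) 0 (hat (curvature l R x)) *v upper (y (x, t))
       = - (block_matrix (hat (ang_vel y (x, t))) (hat (lin_vel y (x, t))) 0 (hat (ang_vel y (x, t)))
              *v (C x *v lower (y (x, t)))) \<longleftrightarrow>
     partial_t T (lin_strain y) (x, t) = partial_x l (lin_vel y) (x, t)
         + cross3 (ang_strain y (x, t)) (lin_vel y (x, t)) - cross3 (ang_vel y (x, t)) (lin_strain y (x, t)) \<and>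
     partial_t T (ang_strain y) (x, t) = partial_x l (ang_vel y) (x, t)
         + cross3 (ang_strain y (x, t)) (ang_vel y (x, t))"
proof -
  define s where "s q = C (fst q) *v lower (y q)" for q
  define v where "v q = upper (y q)" for q
  have s: "Ck_on (Suc 0) (rect l T) s" "(\<lambda>(x, t). C x *v lower (y (x, t))) = s"
    unfolding s_def using y C
    by (auto intro!: Ck_on_lower Ck_on_matrix_vector_mult Ck_on_rect_fst simp del: Ck_on.simps)
  have v: "Ck_on (Suc 0) (rect l T) v"
    unfolding v_def using y by (auto intro!: Ck_on_upper simp del: Ck_on.simps)
  have st: "partial_t T (lin_strain y) (x, t) = upper (partial_t T s (x, t))"
    "partial_t T (ang_strain y) (x, t) = lower (partial_t T s (x, t))"
    unfolding lin_strain_def ang_strain_def s_def[symmetric] fst_conv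
    by (rule partial_t_eqI[OF T t],
        auto intro!: derivative_eq_intros bounded_linear.has_vector_derivative[OF bounded_linear_upper]
          bounded_linear.has_vector_derivative[OF bounded_linear_lower]
          has_partial_t[OF l T s(1) x t])+
  have vx: "partial_x l (lin_vel y) (x, t) = upper (partial_x l v (x, t))"
    "partial_x l (ang_vel y) (x, t) = lower (partial_x l v (x, t))"
    unfolding lin_vel_def ang_vel_def v_def[symmetric]
    by (rule partial_x_eqI[OF l x],
        auto intro!: bounded_linear.has_vector_derivative[OF bounded_linear_upper]
          bounded_linear.has_vector_derivative[OF bounded_linear_lower]
          has_partial_x[OF l T v x t])+
  define st' vx' where "st' = partial_t T s (x, t)" and "vx' = partial_x l v (x, t)"
  have split: "st' - vx' - stack a1 a2 = - stack b1 b2 \<longleftrightarrow>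
      upper st' - upper vx' - a1 = - b1 \<and> lower st' - lower vx' - a2 = - b2" for a1 a2 b1 b2
    unfolding blockwise_eq_iff by (simp add: linear_diff linear_neg bounded_linear.linear
        bounded_linear_upper bounded_linear_lower)
  have V: "upper (y (x, t)) = stack (lin_vel y (x, t)) (ang_vel y (x, t))"
    by (simp add: lin_vel_def ang_vel_def)
  have S: "C x *v lower (y (x, t)) = stack (upper (s (x, t))) (lower (s (x, t)))"
    by (simp add: s_def)
  \<comment> \<open>The angular row has the form of the linear one with the angular velocity as
    \<open>v1\<close> and with \<open>e\<close>, \<open>v2\<close> and \<open>s1\<close> set to
    zero.\<close>
  have "lower st' - lower vx' - cross3 (curvature l R x) (ang_vel y (x, t)) =
      - cross3 (ang_vel y (x, t)) (lower (s (x, t))) \<longleftrightarrow>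
      lower st' = lower vx' + cross3 (lower (s (x, t)) + curvature l R x) (ang_vel y (x, t))"
    using balance_eq_iff[of "lower st'" "lower vx'" "curvature l R x" "ang_vel y (x, t)" 0 0 0 "lower (s (x, t))"]
    by (simp add: cross_skew[of "ang_vel y (x, t)"] )
  then show ?thesis
    unfolding s(2) v_def[symmetric] st vx st'_def[symmetric] vx'_def[symmetric]
    unfolding V[folded v_def] S block_matrix_mult_stack split
    by (simp add: hat_mult balance_eq_iff lin_strain_def ang_strain_def s_def)
qed

text \<open>Both sides of every condition are continuous, so all of them extend from open to closed
  sets. The initial conditions become genuine derivative statements because \<open>p0\<close> and
  \<open>R0\<close> are differentiable.\<close>

lemma E2_iff:
  "y \<in> E2 l T C R p0 R0 \<longleftrightarrow> y \<in> extensional (rect l T) \<and> Ck_on 1 (rect l T) y \<and>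
     (\<forall>x\<in>{0..l}. (p0 has_vector_derivative R0 x *v lin_strain y (x, 0)) (at x within {0..l}) \<and>
        (R0 has_vector_derivative R0 x ** hat (ang_strain y (x, 0))) (at x within {0..l})) \<and>
     (\<forall>q\<in>rect l T.
        partial_t T (lin_strain y) q = partial_x l (lin_vel y) q
          + cross3 (ang_strain y q) (lin_vel y q) - cross3 (ang_vel y q) (lin_strain y q) \<and>
        partial_t T (ang_strain y) q = partial_x l (ang_vel y) q + cross3 (ang_strain y q) (ang_vel y q)) \<and>
     (\<forall>t\<in>{0..T}. lin_vel y (0, t) = 0 \<and> ang_vel y (0, t) = 0)"
    (is "_ \<longleftrightarrow> y \<in> _ \<and> _ \<and> ?I \<and> (\<forall>q\<in>rect l T. ?B1 q \<and> ?B2 q) \<and> ?V")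
proof -
  define init where "init \<longleftrightarrow> (\<forall>x\<in>{0<..<l}.
      vector_derivative p0 (at x within {0..l}) = R0 x *v lin_strain y (x, 0) \<and>
      vector_derivative R0 (at x within {0..l}) = R0 x ** hat (ang_strain y (x, 0)))"
  define bal where "bal \<longleftrightarrow> (\<forall>x\<in>{0<..<l}. \<forall>t\<in>{0<..<T}. ?B1 (x, t) \<and> ?B2 (x, t))"
  define bc where "bc \<longleftrightarrow> (\<forall>t\<in>{0<..<T}. lin_vel y (0, t) = 0 \<and> ang_vel y (0, t) = 0)"
  have E2: "y \<in> E2 l T C R p0 R0 \<longleftrightarrow>
      y \<in> extensional (rect l T) \<and> Ck_on 1 (rect l T) y \<and> init \<and> bal \<and> bc"
  proof (cases "Ck_on 1 (rect l T) y")
    case True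
    have "init \<longleftrightarrow> (\<forall>x\<in>{0<..<l}.
        vector_derivative p0 (at x within {0..l}) = R0 x *v (upper (C x *v lower (y (x, 0))) + e1) \<and>
        vector_derivative R0 (at x within {0..l}) =
          R0 x ** (hat (lower (C x *v lower (y (x, 0)))) + hat (curvature l R x)))"
      by (simp add: init_def lin_strain_def ang_strain_def linear_add bounded_linear.linear bounded_linear_hat)
    moreover have "bal \<longleftrightarrow> (\<forall>x\<in>{0<..<l}. \<forall>t\<in>{0<..<T}.
        partial_t T (\<lambda>(x, t). C x *v lower (y (x, t))) (x, t) - partial_x l (\<lambda>q. upper (y q)) (x, t)
         - block_matrix (hat (curvature l R x)) (hat e1) 0 (hat (curvature l R x)) *v upper (y (x, t))
       = - (block_matrix (hat (ang_vel y (x, t))) (hat (lin_vel y (x, t))) 0 (hat (ang_vel y (x, t)))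
              *v (C x *v lower (y (x, t)))))"
      unfolding bal_def by (intro ball_cong refl balance_laws_iff[OF True, symmetric]) auto
    ultimately show ?thesis
      using True by (simp add: E2_def Let_def bc_def lin_vel_def ang_vel_def)
  qed (simp add: E2_def del: Ck_on.simps One_nat_def)
  have "(init \<longleftrightarrow> ?I) \<and> (bal \<longleftrightarrow> (\<forall>q\<in>rect l T. ?B1 q \<and> ?B2 q)) \<and> (bc \<longleftrightarrow> ?V)" if y: "Ck_on 1 (rect l T) y"
  proof -
    note cont = Ck_on_imp_continuous_on[OF Ck_on_lin_strain[OF y]]
      Ck_on_imp_continuous_on[OF Ck_on_ang_strain[OF y]]
      Ck_on_imp_continuous_on[OF Ck_on_lin_vel[OF y]] Ck_on_imp_continuous_on[OF Ck_on_ang_vel[OF y]]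
    note Ck = Ck_on_lin_strain[OF y] Ck_on_ang_strain[OF y] Ck_on_lin_vel[OF y] Ck_on_ang_vel[OF y]
    note Ck' = Ck[unfolded One_nat_def]
    have pd: "Ck_on (Suc 1) {0..l} p0" "Ck_on (Suc 1) {0..l} R0"
      using Ck_on_fst[OF initial(1)] Ck_on_snd[OF initial(1)] by (simp_all add: numeral_2_eq_2)
    note p0 = Ck_on_Icc_derivative[OF l pd(1)] and R0 = Ck_on_Icc_derivative[OF l pd(2)]
    have restr: "continuous_on {0..l} (\<lambda>x. f (x, 0))" if "continuous_on (rect l T) f"
      for f :: "real \<times> real \<Rightarrow> real^3"
      by (rule continuous_on_compose2[OF that]) (use T in \<open>auto intro!: continuous_intros simp: rect_def\<close>)
    have restr': "continuous_on {0..T} (\<lambda>t. f (0, t))" if "continuous_on (rect l T) f"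
      for f :: "real \<times> real \<Rightarrow> real^3"
      by (rule continuous_on_compose2[OF that]) (use l in \<open>auto intro!: continuous_intros simp: rect_def\<close>)
    have "init \<longleftrightarrow> ?I"
    proof
      assume init
      have R0c: "continuous_on {0..l} R0" using pd(2) Ck_on_imp_continuous_on by blast
      have 1: "vector_derivative p0 (at x within {0..l}) = R0 x *v lin_strain y (x, 0)" if "x \<in> {0..l}" for x
        by (rule continuous_on_Icc_eq[OF l _ _ _ that])
           (use \<open>init\<close> in \<open>auto simp: init_def intro!: Ck_on_imp_continuous_on[OF p0(1)] R0c restr cont
             bounded_bilinear.continuous_on[OF bounded_bilinear_matrix_vector_mult]\<close>)
      have 2: "vector_derivative R0 (at x within {0..l}) = R0 x ** hat (ang_strain y (x, 0))"
        if "x \<in> {0..l}" for x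
        by (rule continuous_on_Icc_eq[OF l _ _ _ that])
           (use \<open>init\<close> in \<open>auto simp: init_def intro!: Ck_on_imp_continuous_on[OF R0(1)] R0c restr cont
             bounded_bilinear.continuous_on[OF bounded_bilinear_matrix_mult]
             bounded_linear.continuous_on[OF bounded_linear_hat]\<close>)
      show ?I using p0(2) R0(2) 1 2 by (metis (no_types, lifting))
    next
      assume ?I
      then show init
        unfolding init_def by (intro ballI conjI vector_derivative_within_closed_interval[OF l]) auto
    qed
    moreover have "bal \<longleftrightarrow> (\<forall>q\<in>rect l T. ?B1 q \<and> ?B2 q)"
    proof
      assume bal
      note c = Ck'[THEN Ck_on_partial_x[OF l T], THEN Ck_on_imp_continuous_on]
        Ck'[THEN Ck_on_partial_t[OF l T], THEN Ck_on_imp_continuous_on]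
      have "?B1 q" if "q \<in> rect l T" for q
        by (rule continuous_on_rect_eq[OF l T _ _ _ that])
           (use \<open>bal\<close> in \<open>auto simp: bal_def intro!: c cont continuous_on_add continuous_on_diff continuous_on_cross\<close>)
      moreover have "?B2 q" if "q \<in> rect l T" for q
        by (rule continuous_on_rect_eq[OF l T _ _ _ that])
           (use \<open>bal\<close> in \<open>auto simp: bal_def intro!: c cont continuous_on_add continuous_on_cross\<close>)
      ultimately show "\<forall>q\<in>rect l T. ?B1 q \<and> ?B2 q" by blast
    qed (auto simp: bal_def rect_def)
    moreover have "bc \<longleftrightarrow> ?V"
    proof
      assume bc
      have "lin_vel y (0, t) = 0" "ang_vel y (0, t) = 0" if "t \<in> {0..T}" for t
        by (rule continuous_on_Icc_eq[OF T restr'[OF cont(3)] continuous_on_const _ that]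
            continuous_on_Icc_eq[OF T restr'[OF cont(4)] continuous_on_const _ that];
            use \<open>bc\<close> in \<open>simp add: bc_def\<close>)+
      then show ?V by blast
    qed (simp add: bc_def)
    ultimately show ?thesis by blast
  qed
  with E2 show ?thesis by blast
qed

section \<open>The transformation as an overdetermined first-order system\<close>

text \<open>Each ingredient of the transformation is invertible pointwise: Q^T by Q,
  \<open>matrix_inv (C x)\<close> by \<open>C x\<close>, and \<open>vec_of_skew\<close> by
  \<open>hat\<close>, since its arguments are skew-symmetric.\<close>

lemma transf_eq_iff:
  assumes P: "Ck_on 2 (rect l T) P" and rot: "\<And>q. q \<in> rect l T \<Longrightarrow> rotation_matrix (snd (P q))"
    and y: "y \<in> extensional (rect l T)"
  shows "transf l T C R P = y \<longleftrightarrow> (\<forall>q\<in>rect l T.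
     partial_x l (\<lambda>q. fst (P q)) q = snd (P q) *v lin_strain y q \<and>
     partial_t T (\<lambda>q. fst (P q)) q = snd (P q) *v lin_vel y q \<and>
     partial_x l (\<lambda>q. snd (P q)) q = snd (P q) ** hat (ang_strain y q) \<and>
     partial_t T (\<lambda>q. snd (P q)) q = snd (P q) ** hat (ang_vel y q))"
proof -
  let ?p = "\<lambda>q. fst (P q)" and ?Q = "\<lambda>q. snd (P q)"
  have Q: "Ck_on (Suc (Suc 0)) (rect l T) ?Q" using Ck_on_snd[OF P] by (simp add: numeral_2_eq_2)
  note Q' = Ck_on_rect_partials[OF l T Q]
  have *: "transf l T C R P q = y q \<longleftrightarrow>
      partial_x l ?p q = ?Q q *v lin_strain y q \<and> partial_t T ?p q = ?Q q *v lin_vel y q \<and>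
      partial_x l ?Q q = ?Q q ** hat (ang_strain y q) \<and> partial_t T ?Q q = ?Q q ** hat (ang_vel y q)"
    if q: "q \<in> rect l T" for q
  proof -
    obtain x t where xt: "q = (x, t)" and x: "x \<in> {0..l}" and t: "t \<in> {0..T}"
      using q unfolding rect_def by blast
    have skew_x: "transpose (transpose (?Q q) ** partial_x l ?Q q) = - (transpose (?Q q) ** partial_x l ?Q q)"
      unfolding xt
      by (rule transpose_mult_derivative_skew[OF l _ x Q'(3)[OF x t]]) (use rot t in \<open>simp add: rect_def\<close>)
    have skew_t: "transpose (transpose (?Q q) ** partial_t T ?Q q) = - (transpose (?Q q) ** partial_t T ?Q q)"
      unfolding xt
      by (rule transpose_mult_derivative_skew[OF T _ t Q'(4)[OF x t]]) (use rot x in \<open>simp add: rect_def\<close>)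
    have vee: "vec_of_skew M = w \<longleftrightarrow> M = hat w" if "transpose M = - M" for M w
      using that by (metis hat_vee vec_of_skew_hat)
    have inv: "matrix_inv (C x) *v a = b \<longleftrightarrow> a = C x *v b" for a b
      using matrix_inv_right[OF invertible_C[OF x]] matrix_inv_left[OF invertible_C[OF x]]
      by (metis matrix_vector_mul_assoc matrix_vector_mul_lid)
    note rot' = rotation_mult_eq_iff[OF rot[OF q]]
    show ?thesis
      using q skew_x skew_t
      by (simp add: transf_def Let_def xt blockwise_eq_iff[of "stack _ _"] inv vee rot'[unfolded xt]
          lin_vel_def ang_vel_def lin_strain_def ang_strain_def
          diff_eq_eq del: transpose_matrix_vector) blast
  qed
  have "transf l T C R P \<in> extensional (rect l T)" by (simp add: transf_def Let_def)
  then have "transf l T C R P = y \<longleftrightarrow> (\<forall>q\<in>rect l T. transf l T C R P q = y q)"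
    using y extensionalityI by blast
  with * show ?thesis by simp
qed

lemma Ck_on_transf:
  assumes P: "Ck_on 2 (rect l T) P" and rot: "\<And>q. q \<in> rect l T \<Longrightarrow> rotation_matrix (snd (P q))"
  shows "Ck_on 1 (rect l T) (transf l T C R P)"
proof -
  let ?p = "\<lambda>q. fst (P q)" and ?Q = "\<lambda>q. snd (P q)"
  have p: "Ck_on (Suc 1) (rect l T) ?p" and Q: "Ck_on (Suc 1) (rect l T) ?Q"
    using Ck_on_fst[OF P] Ck_on_snd[OF P] by (simp_all add: numeral_2_eq_2)
  note p' = Ck_on_rect_partials[OF l T p] and Q' = Ck_on_rect_partials[OF l T Q]
  have eq: "transf l T C R P q = stack
      (stack (transpose (?Q q) *v partial_t T ?p q) (vee (transpose (?Q q) ** partial_t T ?Q q)))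
      (matrix_inv (C (fst q)) *v stack (transpose (?Q q) *v partial_x l ?p q - e1)
        (vee (transpose (?Q q) ** partial_x l ?Q q) - curvature l R (fst q)))"
    if q: "q \<in> rect l T" for q
  proof -
    obtain x t where xt: "q = (x, t)" and x: "x \<in> {0..l}" and t: "t \<in> {0..T}"
      using q unfolding rect_def by blast
    have "transpose (transpose (?Q q) ** partial_x l ?Q q) = - (transpose (?Q q) ** partial_x l ?Q q)"
      unfolding xt
      by (rule transpose_mult_derivative_skew[OF l _ x Q'(3)[OF x t]]) (use rot t in \<open>simp add: rect_def\<close>)
    moreover have "transpose (transpose (?Q q) ** partial_t T ?Q q) = - (transpose (?Q q) ** partial_t T ?Q q)"
      unfolding xt
      by (rule transpose_mult_derivative_skew[OF T _ t Q'(4)[OF x t]]) (use rot x in \<open>simp add: rect_def\<close>)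
    ultimately show ?thesis
      using q by (simp add: transf_def Let_def xt vec_of_skew_eq_vee del: transpose_matrix_vector)
  qed
  have inv: "invertible (C (fst q))" if "q \<in> rect l T" for q
    using that invertible_C by (auto simp: rect_def)
  show ?thesis
    by (rule Ck_on_cong[THEN iffD2, OF eq])
       (intro Ck_on_stack Ck_on_matrix_vector_mult Ck_on_matrix_inv_mult Ck_on_transpose Ck_on_vee
         Ck_on_matrix_mult Ck_on_diff Ck_on_const Ck_on_rect_fst C Ck_on_curvature inv p' Q'
         Ck_on_Suc_imp[OF Q] | assumption)+
qed

text \<open>The balance laws say that the mixed second derivatives of position and rotation agree;
  the initial and boundary conditions come from differentiating those of \<open>E1\<close> along the
  edges.\<close>

lemma transf_in_E2:
  assumes P: "P \<in> E1 l T fp fR p0 R0"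
  shows "transf l T C R P \<in> E2 l T C R p0 R0"
proof -
  define p Q y where "p q = fst (P q)" and "Q q = snd (P q)" and "y = transf l T C R P" for q
  note P' = P[unfolded E1_iff]
  have rot: "rotation_matrix (Q q)" if "q \<in> rect l T" for q using P' that by (simp add: Q_def)
  have Ck: "Ck_on (Suc (Suc 0)) (rect l T) p" "Ck_on (Suc (Suc 0)) (rect l T) Q"
    using P' Ck_on_fst Ck_on_snd by (auto simp: p_def [abs_def] Q_def [abs_def] numeral_2_eq_2 simp del: Ck_on.simps)
  note p' = Ck_on_rect_partials[OF l T Ck(1)] and Q' = Ck_on_rect_partials[OF l T Ck(2)]
  have y_ext: "y \<in> extensional (rect l T)" by (simp add: y_def transf_def Let_def)
  have y1: "Ck_on 1 (rect l T) y" unfolding y_def by (rule Ck_on_transf) (use P' in auto)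
  have eqs: "partial_x l p q = Q q *v lin_strain y q" "partial_t T p q = Q q *v lin_vel y q"
    "partial_x l Q q = Q q ** hat (ang_strain y q)" "partial_t T Q q = Q q ** hat (ang_vel y q)"
    if "q \<in> rect l T" for q
    using transf_eq_iff[of P y] P' y_ext that
    unfolding p_def[symmetric] Q_def[symmetric] y_def[symmetric] by blast+
  note Ck_y = Ck_on_lin_strain[OF y1] Ck_on_ang_strain[OF y1] Ck_on_lin_vel[OF y1] Ck_on_ang_vel[OF y1]
  note dt = Ck_y(1,2)[unfolded One_nat_def, THEN has_partial_t[OF l T]]
    and dx = Ck_y(3,4)[unfolded One_nat_def, THEN has_partial_x[OF l T]]
  have init: "(p0 has_vector_derivative R0 x *v lin_strain y (x, 0)) (at x within {0..l})"
    "(R0 has_vector_derivative R0 x ** hat (ang_strain y (x, 0))) (at x within {0..l})"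
    if x: "x \<in> {0..l}" for x
  proof -
    have q: "(x, 0) \<in> rect l T" using x T by (simp add: rect_def)
    have P0: "p (x, 0) = p0 x" "Q (x, 0) = R0 x" if "x \<in> {0..l}" for x
      using P' that by (simp_all add: p_def Q_def)
    show "(p0 has_vector_derivative R0 x *v lin_strain y (x, 0)) (at x within {0..l})"
      by (rule has_vector_derivative_transform[OF x, of _ "\<lambda>x. p (x, 0)"])
         (use p'(3)[OF x, of 0] eqs(1)[OF q] P0 x T in auto)
    show "(R0 has_vector_derivative R0 x ** hat (ang_strain y (x, 0))) (at x within {0..l})"
      by (rule has_vector_derivative_transform[OF x, of _ "\<lambda>x. Q (x, 0)"])
         (use Q'(3)[OF x, of 0] eqs(3)[OF q] P0 x T in auto)
  qed
  \<comment> \<open>The clamped end does not move, so the time derivatives vanish there, and the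
    rotation cancels.\<close>
  have bc: "lin_vel y (0, t) = 0" "ang_vel y (0, t) = 0" if t: "t \<in> {0..T}" for t
  proof -
    have q: "(0, t) \<in> rect l T" using t l by (simp add: rect_def)
    have "p (0, t) = fp" "Q (0, t) = fR" if "t \<in> {0..T}" for t
      using P' that by (simp_all add: p_def Q_def)
    then have "partial_t T p (0, t) = 0" "partial_t T Q (0, t) = 0"
      by (auto intro!: partial_t_eqI[OF T t] has_vector_derivative_transform[OF t _ has_vector_derivative_const])
    then have "Q (0, t) *v lin_vel y (0, t) = Q (0, t) *v 0" "Q (0, t) ** hat (ang_vel y (0, t)) = Q (0, t) ** 0"
      using eqs[OF q] by simp_all
    then have "lin_vel y (0, t) = 0" "hat (ang_vel y (0, t)) = 0"
      unfolding rotation_cancel[OF rot[OF q]] .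
    then show "lin_vel y (0, t) = 0" "ang_vel y (0, t) = 0"
      using vee_hat[of "ang_vel y (0, t)"] linear_0[OF bounded_linear.linear[OF bounded_linear_vee]] by simp_all
  qed
  have bal: "partial_t T (lin_strain y) q = partial_x l (lin_vel y) q
      + cross3 (ang_strain y q) (lin_vel y q) - cross3 (ang_vel y q) (lin_strain y q)" (is ?lin)
    "partial_t T (ang_strain y) q = partial_x l (ang_vel y) q + cross3 (ang_strain y q) (ang_vel y q)" (is ?ang)
    if q: "q \<in> rect l T" for q
  proof -
    obtain x t where xt: "q = (x, t)" and x: "x \<in> {0..l}" and t: "t \<in> {0..T}"
      using q unfolding rect_def by blast
    have mem: "(\<xi>, t) \<in> rect l T" "(x, \<tau>) \<in> rect l T" if "\<xi> \<in> {0..l}" "\<tau> \<in> {0..T}" for \<xi> \<tau>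
      using that x t by (simp_all add: rect_def)
    have "partial_t T (partial_x l p) q = Q q *v partial_t T (lin_strain y) q + partial_t T Q q *v lin_strain y q"
      unfolding xt by (rule partial_t_eqI[OF T t], rule has_vector_derivative_transform[OF t])
        (use mem x eqs(1) in \<open>auto intro!: has_vector_derivative_matrix_vector_mult Q'(4)[OF x t] dt(1)[OF x t]\<close>)
    moreover have "partial_x l (partial_t T p) q = Q q *v partial_x l (lin_vel y) q + partial_x l Q q *v lin_vel y q"
      unfolding xt by (rule partial_x_eqI[OF l x], rule has_vector_derivative_transform[OF x])
        (use mem t eqs(2) in \<open>auto intro!: has_vector_derivative_matrix_vector_mult Q'(3)[OF x t] dx(1)[OF x t]\<close>)
    \<comment> \<open>Equating the mixed derivatives and substituting the derivatives of
      \<open>Q\<close> leaves a common factor \<open>Q q\<close>, which cancels.\<close>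
    ultimately have "Q q *v (partial_t T (lin_strain y) q + cross3 (ang_vel y q) (lin_strain y q)) =
        Q q *v (partial_x l (lin_vel y) q + cross3 (ang_strain y q) (lin_vel y q))"
      using partial_t_partial_x[OF l T Ck(1) x t] eqs(3,4)[OF q]
      by (simp add: xt matrix_vector_right_distrib flip: hat_mult matrix_vector_mul_assoc)
    then show ?lin
      unfolding rotation_cancel[OF rot[OF q]] by (simp add: algebra_simps)
    have "partial_t T (partial_x l Q) q =
        Q q ** hat (partial_t T (ang_strain y) q) + partial_t T Q q ** hat (ang_strain y q)"
      unfolding xt by (rule partial_t_eqI[OF T t], rule has_vector_derivative_transform[OF t])
        (use mem x eqs(3) in \<open>auto intro!: has_vector_derivative_matrix_mult has_vector_derivative_hat
          Q'(4)[OF x t] dt(2)[OF x t]\<close>)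
    moreover have "partial_x l (partial_t T Q) q =
        Q q ** hat (partial_x l (ang_vel y) q) + partial_x l Q q ** hat (ang_vel y q)"
      unfolding xt by (rule partial_x_eqI[OF l x], rule has_vector_derivative_transform[OF x])
        (use mem t eqs(4) in \<open>auto intro!: has_vector_derivative_matrix_mult has_vector_derivative_hat
          Q'(3)[OF x t] dx(2)[OF x t]\<close>)
    ultimately have "Q q ** (hat (partial_t T (ang_strain y) q) + hat (ang_vel y q) ** hat (ang_strain y q)) =
        Q q ** (hat (partial_x l (ang_vel y) q) + hat (ang_strain y q) ** hat (ang_vel y q))"
      using partial_t_partial_x[OF l T Ck(2) x t] eqs(3,4)[OF q]
      by (simp add: xt matrix_add_ldistrib matrix_mul_assoc)
    then have "hat (partial_t T (ang_strain y) q) = hat (partial_x l (ang_vel y) q)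
        + hat (cross3 (ang_strain y q) (ang_vel y q))"
      unfolding rotation_cancel[OF rot[OF q]] by (simp add: algebra_simps flip: hat_commutator)
    then have "hat (partial_t T (ang_strain y) q) =
        hat (partial_x l (ang_vel y) q + cross3 (ang_strain y q) (ang_vel y q))"
      by (simp add: linear_add bounded_linear.linear bounded_linear_hat)
    then show ?ang by (metis vee_hat)
  qed
  show ?thesis
    unfolding y_def[symmetric] E2_iff using y_ext y1 init bal bc by blast
qed

section \<open>Injectivity of the transformation\<close>

text \<open>For fixed t, two preimages of \<open>y\<close> solve the same equations in x with the
  same value at x = 0. Equality of the rotations comes first; then the positions have the same
  x-derivative.\<close>

lemma inj_on_transf: "inj_on (transf l T C R) (E1 l T fp fR p0 R0)"
proof (rule inj_onI)
  fix P P' assume P: "P \<in> E1 l T fp fR p0 R0" "P' \<in> E1 l T fp fR p0 R0"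
    and eq: "transf l T C R P = transf l T C R P'"
  define y where "y = transf l T C R P"
  have y: "y \<in> extensional (rect l T)" by (simp add: y_def transf_def Let_def)
  \<comment> \<open>Stated for an arbitrary preimage of \<open>y\<close>, so that it can be
    instantiated for both.\<close>
  have d: "x \<in> {0..l} \<Longrightarrow> t \<in> {0..T} \<Longrightarrow> ((\<lambda>\<xi>. fst (P (\<xi>, t))) has_vector_derivative
        snd (P (x, t)) *v lin_strain y (x, t)) (at x within {0..l})"
    "x \<in> {0..l} \<Longrightarrow> t \<in> {0..T} \<Longrightarrow> ((\<lambda>\<xi>. snd (P (\<xi>, t))) has_vector_derivative
        snd (P (x, t)) ** hat (ang_strain y (x, t))) (at x within {0..l})"
    "x \<in> {0..l} \<Longrightarrow> t \<in> {0..T} \<Longrightarrow> rotation_matrix (snd (P (x, t)))"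
    "t \<in> {0..T} \<Longrightarrow> P (0, t) = (fp, fR)" "P \<in> extensional (rect l T)"
    if P: "P \<in> E1 l T fp fR p0 R0" and yP: "transf l T C R P = y" for P x t
  proof -
    note P' = P[unfolded E1_iff]
    have Ck: "Ck_on (Suc 1) (rect l T) (\<lambda>q. fst (P q))" "Ck_on (Suc 1) (rect l T) (\<lambda>q. snd (P q))"
      using P' Ck_on_fst Ck_on_snd by (auto simp: numeral_2_eq_2 simp del: Ck_on.simps)
    have eqs: "partial_x l (\<lambda>q. fst (P q)) q = snd (P q) *v lin_strain y q"
      "partial_x l (\<lambda>q. snd (P q)) q = snd (P q) ** hat (ang_strain y q)" if "q \<in> rect l T" for q
      using transf_eq_iff[of P y] P' y that yP by blast+
    show "((\<lambda>\<xi>. fst (P (\<xi>, t))) has_vector_derivative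
        snd (P (x, t)) *v lin_strain y (x, t)) (at x within {0..l})"
      "((\<lambda>\<xi>. snd (P (\<xi>, t))) has_vector_derivative
        snd (P (x, t)) ** hat (ang_strain y (x, t))) (at x within {0..l})"
      if "x \<in> {0..l}" "t \<in> {0..T}"
      using has_partial_x[OF l T Ck(1) that] has_partial_x[OF l T Ck(2) that] eqs[of "(x, t)"] that
      by (simp_all add: rect_def)
    show "rotation_matrix (snd (P (x, t)))" if "x \<in> {0..l}" "t \<in> {0..T}"
      using P' that by (simp add: rect_def)
    show "P (0, t) = (fp, fR)" if "t \<in> {0..T}" using P' that by simp
    show "P \<in> extensional (rect l T)" using P' by simp
  qed
  note dP = d[OF P(1) y_def[symmetric]] and dP' = d[OF P(2) eq[symmetric, folded y_def]]
  have "P (x, t) = P' (x, t)" if x: "x \<in> {0..l}" and t: "t \<in> {0..T}" for x t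
  proof -
    have zero: "0 \<in> {0..l}" using l by simp
    have Q: "snd (P (x, t)) = snd (P' (x, t))" if x: "x \<in> {0..l}" for x
      by (rule skew_ode_unique[of l "\<lambda>x. snd (P (x, t))" "\<lambda>x. hat (ang_strain y (x, t))"
            "\<lambda>x. snd (P' (x, t))"])
         (use dP dP' x t zero transpose_hat rotation_fR in auto)
    have "fst (P (x, t)) - fst (P' (x, t)) = fst (P (0, t)) - fst (P' (0, t))"
    proof (rule has_vector_derivative_zero_imp_eq[OF _ x, of "\<lambda>x. fst (P (x, t)) - fst (P' (x, t))"])
      fix u assume u: "u \<in> {0..l}"
      show "((\<lambda>x. fst (P (x, t)) - fst (P' (x, t))) has_vector_derivative 0) (at u within {0..l})"
        using has_vector_derivative_diff[OF dP(1)[OF u t] dP'(1)[OF u t]] Q[OF u] by simp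
    qed
    with dP(4)[OF t] dP'(4)[OF t] Q[OF x] show ?thesis by (simp add: prod_eq_iff)
  qed
  then show "P = P'"
    by (intro extensionalityI[OF dP(5) dP'(5)]) (auto simp: rect_def)
qed

section \<open>Surjectivity: integrating the overdetermined system\<close>

text \<open>Only the equation in x is solved; the equation in t is derived from it, the angular
  balance law and the vanishing angular velocity at x = 0.\<close>

lemma rotation_exists:
  assumes y: "y \<in> E2 l T C R p0 R0"
  obtains Q where "\<And>q. q \<in> rect l T \<Longrightarrow> rotation_matrix (Q q)" "\<And>t. t \<in> {0..T} \<Longrightarrow> Q (0, t) = fR"
    and "\<And>x t. x \<in> {0..l} \<Longrightarrow> t \<in> {0..T} \<Longrightarrow>
      ((\<lambda>\<xi>. Q (\<xi>, t)) has_vector_derivative Q (x, t) ** hat (ang_strain y (x, t))) (at x within {0..l})"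
    and "\<And>x t. x \<in> {0..l} \<Longrightarrow> t \<in> {0..T} \<Longrightarrow>
      ((\<lambda>\<tau>. Q (x, \<tau>)) has_vector_derivative Q (x, t) ** hat (ang_vel y (x, t))) (at t within {0..T})"
proof -
  note y' = y[unfolded E2_iff]
  have y1: "Ck_on 1 (rect l T) y" using y' by blast
  define A where "A q = hat (ang_strain y q)" for q
  define B where "B q = hat (ang_vel y q)" for q
  define At where "At q = hat (partial_t T (ang_strain y) q)" for q
  define Bx where "Bx q = hat (partial_x l (ang_vel y) q)" for q
  have Ck: "Ck_on (Suc 0) (rect l T) (ang_strain y)" "Ck_on (Suc 0) (rect l T) (ang_vel y)"
    using Ck_on_ang_strain[OF y1] Ck_on_ang_vel[OF y1] by (simp_all only: One_nat_def)
  \<comment> \<open>The angular balance law in matrix form: the zero-curvature condition for the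
    pair \<open>A\<close>, \<open>B\<close>.\<close>
  have flat: "At q = Bx q + A q ** B q - B q ** A q" if "q \<in> rect l T" for q
  proof -
    have "At q = hat (partial_x l (ang_vel y) q + cross3 (ang_strain y q) (ang_vel y q))"
      using y' that by (simp add: At_def)
    also have "\<dots> = Bx q + hat (cross3 (ang_strain y q) (ang_vel y q))"
      by (simp add: Bx_def linear_add bounded_linear.linear bounded_linear_hat)
    finally show ?thesis unfolding A_def B_def hat_commutator[symmetric] by simp
  qed
  have A_skew: "transpose (A q) = - A q" for q by (simp add: A_def transpose_hat)
  have A_cont: "continuous_on (rect l T) A"
    unfolding A_def using Ck_on_hat[OF Ck(1)] by (rule Ck_on_imp_continuous_on)
  have At_cont: "continuous_on (rect l T) At"
    unfolding At_def using Ck_on_partial_t[OF l T Ck(1)] Ck_on_hat Ck_on_imp_continuous_on by blast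
  have dA: "((\<lambda>\<tau>. A (x, \<tau>)) has_vector_derivative At (x, t)) (at t within {0..T})"
    if "x \<in> {0..l}" "t \<in> {0..T}" for x t
    unfolding A_def At_def by (intro has_vector_derivative_hat has_partial_t[OF l T Ck(1)] that)
  have dB: "((\<lambda>\<xi>. B (\<xi>, t)) has_vector_derivative Bx (x, t)) (at x within {0..l})"
    if "x \<in> {0..l}" "t \<in> {0..T}" for x t
    unfolding B_def Bx_def by (intro has_vector_derivative_hat has_partial_x[OF l T Ck(2)] that)
  have B0: "B (0, t) = 0" if "t \<in> {0..T}" for t
    using y' that linear_0[OF bounded_linear.linear[OF bounded_linear_hat]] by (simp add: B_def)
  have "\<exists>q. q 0 = fR \<and> (\<forall>x\<in>{0..l}. (q has_vector_derivative q x ** A (x, t)) (at x within {0..l}))"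
    if "t \<in> {0..T}" for t
  proof -
    have "continuous_on {0..l} (\<lambda>x. A (x, t))"
      by (rule continuous_on_compose2[OF A_cont]) (use that in \<open>auto intro!: continuous_intros simp: rect_def\<close>)
    from linear_ode_exists[OF bounded_bilinear_matrix_mult this l, of fR] show ?thesis by metis
  qed
  \<comment> \<open>The solutions are chosen separately for each t, so nothing is known yet about
    their dependence on t.\<close>
  then obtain G where G: "\<And>t. t \<in> {0..T} \<Longrightarrow> G t 0 = fR" "\<And>t x. t \<in> {0..T} \<Longrightarrow> x \<in> {0..l} \<Longrightarrow>
      (G t has_vector_derivative G t x ** A (x, t)) (at x within {0..l})" by metis
  define Q where "Q = (\<lambda>(x, t). G t x)"
  have Q0: "Q (0, t) = fR" if "t \<in> {0..T}" for t using G(1) that by (simp add: Q_def)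
  have dQ: "((\<lambda>\<xi>. Q (\<xi>, t)) has_vector_derivative Q (x, t) ** A (x, t)) (at x within {0..l})"
    if "x \<in> {0..l}" "t \<in> {0..T}" for x t
    using G(2)[OF that(2,1)] by (simp add: Q_def)
  have rot: "rotation_matrix (Q (x, t))" if x: "x \<in> {0..l}" and t: "t \<in> {0..T}" for x t
    by (rule skew_ode_rotation[OF dQ[OF _ t] A_skew _ x]) (use Q0[OF t] rotation_fR in auto)
  have dtQ: "((\<lambda>\<tau>. Q (x, \<tau>)) has_vector_derivative Q (x, t0) ** B (x, t0)) (at t0 within {0..T})"
    if x: "x \<in> {0..l}" and t0: "t0 \<in> {0..T}" for x t0
  proof -
    \<comment> \<open>The rotation relative to time \<open>t0\<close>. It solves a linear equation
      with coefficient \<open>E\<close>, where \<open>F\<close> is the identity and \<open>E\<close>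
      is zero at \<open>t = t0\<close>.\<close>
    define F where "F = (\<lambda>(x, t). Q (x, t) ** transpose (Q (x, t0)))"
    define E where "E = (\<lambda>(x, t). Q (x, t0) ** (A (x, t) - A (x, t0)) ** transpose (Q (x, t0)))"
    define Et where "Et = (\<lambda>(x, t). Q (x, t0) ** At (x, t) ** transpose (Q (x, t0)))"
    \<comment> \<open>The expected t-derivative of \<open>F\<close> at \<open>t0\<close>, obtained
      from the desired equation Q_t = Q B.\<close>
    define h where "h x = Q (x, t0) ** B (x, t0) ** transpose (Q (x, t0))" for x
    have Q_inv: "transpose (Q (x, t0)) ** Q (x, t0) = mat 1" "Q (x, t0) ** transpose (Q (x, t0)) = mat 1"
      if "x \<in> {0..l}" for x
      using rotation_matrixD[OF rot[OF that t0]] .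
    have "((\<lambda>t. F (x, t)) has_vector_derivative h x) (at t0 within {0..T})"
    proof (rule linear_ode_parameter_derivative[OF l t0])
      fix x t assume x: "x \<in> {0..l}" and t: "t \<in> {0..T}"
      have "((\<lambda>\<xi>. F (\<xi>, t)) has_vector_derivative
          Q (x, t) ** transpose (Q (x, t0) ** A (x, t0)) + Q (x, t) ** A (x, t) ** transpose (Q (x, t0)))
          (at x within {0..l})"
        unfolding F_def prod.case
        by (intro has_vector_derivative_matrix_mult has_vector_derivative_transpose dQ x t t0)
      \<comment> \<open>The inner factors cancel, and skewness of \<open>A\<close> turns the term
        with \<open>A (x, t0)\<close> into the one coming from the transposed factor.\<close>
      moreover have "F (x, t) ** E (x, t) = Q (x, t) ** (transpose (Q (x, t0)) ** Q (x, t0)) **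
          (A (x, t) - A (x, t0)) ** transpose (Q (x, t0))"
        by (simp add: F_def E_def matrix_mul_assoc)
      then have "F (x, t) ** E (x, t) =
          Q (x, t) ** transpose (Q (x, t0) ** A (x, t0)) + Q (x, t) ** A (x, t) ** transpose (Q (x, t0))"
        by (simp add: Q_inv[OF x] matrix_transpose_mul A_skew matrix_mul_assoc
            bounded_bilinear.diff_left[OF bounded_bilinear_matrix_mult]
            bounded_bilinear.diff_right[OF bounded_bilinear_matrix_mult]
            bounded_bilinear.minus_left[OF bounded_bilinear_matrix_mult]
            bounded_bilinear.minus_right[OF bounded_bilinear_matrix_mult])
      ultimately show "((\<lambda>\<xi>. F (\<xi>, t)) has_vector_derivative F (x, t) ** E (x, t)) (at x within {0..l})"
        by simp
      show "((\<lambda>\<tau>. E (x, \<tau>)) has_vector_derivative Et (x, t)) (at t within {0..T})"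
      proof -
        have "bounded_linear (\<lambda>M. Q (x, t0) ** M ** transpose (Q (x, t0)))"
          by (intro bounded_linear_compose[OF bounded_bilinear.bounded_linear_left[OF bounded_bilinear_matrix_mult]]
              bounded_bilinear.bounded_linear_right[OF bounded_bilinear_matrix_mult])
        from bounded_linear.has_vector_derivative[OF this
            has_vector_derivative_diff[OF dA[OF x t] has_vector_derivative_const]]
        show ?thesis by (simp add: E_def Et_def)
      qed
    next
      fix x assume x: "x \<in> {0..l}"
      have q: "(x, t0) \<in> rect l T" using x t0 by (simp add: rect_def)
      show "F (x, t0) = mat 1" "E (x, t0) = 0"
        using Q_inv[OF x] by (simp_all add: F_def E_def bounded_bilinear.zero_left[OF bounded_bilinear_matrix_mult]
            bounded_bilinear.zero_right[OF bounded_bilinear_matrix_mult])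
      have "(h has_vector_derivative Q (x, t0) ** B (x, t0) ** transpose (Q (x, t0) ** A (x, t0)) +
          (Q (x, t0) ** Bx (x, t0) + Q (x, t0) ** A (x, t0) ** B (x, t0)) ** transpose (Q (x, t0)))
          (at x within {0..l})"
        unfolding h_def
        by (intro has_vector_derivative_matrix_mult has_vector_derivative_transpose dQ dB x t0)
      \<comment> \<open>Substituting \<open>flat\<close> for \<open>At\<close> produces exactly the
        three terms of the product rule for \<open>h\<close>; the term with B A changes sign by
        skewness of \<open>A\<close>.\<close>
      moreover have "Et (x, t0) = Q (x, t0) ** B (x, t0) ** transpose (Q (x, t0) ** A (x, t0)) +
          (Q (x, t0) ** Bx (x, t0) + Q (x, t0) ** A (x, t0) ** B (x, t0)) ** transpose (Q (x, t0))"
        by (simp add: Et_def flat[OF q] matrix_transpose_mul A_skew matrix_mul_assoc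
            bounded_bilinear.diff_left[OF bounded_bilinear_matrix_mult]
            bounded_bilinear.diff_right[OF bounded_bilinear_matrix_mult]
            bounded_bilinear.add_left[OF bounded_bilinear_matrix_mult]
            bounded_bilinear.add_right[OF bounded_bilinear_matrix_mult]
            bounded_bilinear.minus_left[OF bounded_bilinear_matrix_mult]
            bounded_bilinear.minus_right[OF bounded_bilinear_matrix_mult])
      ultimately show "(h has_vector_derivative Et (x, t0)) (at x within {0..l})" by simp
    next
      show "F (0, t) = mat 1" if "t \<in> {0..T}" for t
        using rotation_matrixD[OF rotation_fR] by (simp add: F_def Q0[OF that] Q0[OF t0])
      show "h 0 = 0"
        using B0[OF t0] by (simp add: h_def bounded_bilinear.zero_left[OF bounded_bilinear_matrix_mult]
            bounded_bilinear.zero_right[OF bounded_bilinear_matrix_mult])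
      show "norm (F q) \<le> CARD(3)" if "q \<in> rect l T" for q
      proof (rule norm_orthogonal_matrix_le)
        show "orthogonal_matrix (F q)"
          using that rot t0 by (auto simp: F_def rect_def rotation_matrix_def intro!: orthogonal_matrix_mul)
      qed
      have "continuous_on {0..l} (\<lambda>x. Q (x, t0))"
        by (rule continuous_on_vector_derivative) (rule dQ[OF _ t0])
      then have "continuous_on (rect l T) (\<lambda>q. Q (fst q, t0))"
        by (rule continuous_on_compose2) (auto simp: rect_def intro!: continuous_intros)
      then show "continuous_on (rect l T) Et"
        unfolding Et_def split_beta prod.collapse
        by (intro bounded_bilinear.continuous_on[OF bounded_bilinear_matrix_mult]
            bounded_linear.continuous_on[OF bounded_linear_transpose] At_cont)
    qed fact
    \<comment> \<open>Multiplying by the constant \<open>Q (x, t0)\<close> recovers \<open>Q\<close>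
      from \<open>F\<close>, and Q B from \<open>h\<close>.\<close>
    then have "((\<lambda>t. F (x, t) ** Q (x, t0)) has_vector_derivative h x ** Q (x, t0)) (at t0 within {0..T})"
      by (rule bounded_linear.has_vector_derivative[OF
            bounded_bilinear.bounded_linear_left[OF bounded_bilinear_matrix_mult]])
    then show ?thesis
      by (simp add: F_def h_def Q_inv[OF x] flip: matrix_mul_assoc)
  qed
  show thesis
    by (rule that[of Q]) (use rot Q0 dQ dtQ in \<open>auto simp: rect_def A_def B_def\<close>)
qed

text \<open>For each t the position is the primitive in x of \<open>g\<close>. By the linear balance
  law the t-derivative of \<open>g\<close> is the x-derivative of \<open>Q q *v lin_vel y q\<close>,
  which vanishes at x = 0, so differentiation under the integral sign gives the equation in
  t.\<close>

lemma position_exists: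
  assumes y: "y \<in> E2 l T C R p0 R0"
    and dQ: "\<And>x t. x \<in> {0..l} \<Longrightarrow> t \<in> {0..T} \<Longrightarrow>
      ((\<lambda>\<xi>. Q (\<xi>, t)) has_vector_derivative Q (x, t) ** hat (ang_strain y (x, t))) (at x within {0..l})"
    and dtQ: "\<And>x t. x \<in> {0..l} \<Longrightarrow> t \<in> {0..T} \<Longrightarrow>
      ((\<lambda>\<tau>. Q (x, \<tau>)) has_vector_derivative Q (x, t) ** hat (ang_vel y (x, t))) (at t within {0..T})"
    and Q: "continuous_on (rect l T) Q"
  obtains p where "\<And>t. t \<in> {0..T} \<Longrightarrow> p (0, t) = fp"
    and "\<And>x t. x \<in> {0..l} \<Longrightarrow> t \<in> {0..T} \<Longrightarrow>
      ((\<lambda>\<xi>. p (\<xi>, t)) has_vector_derivative Q (x, t) *v lin_strain y (x, t)) (at x within {0..l})"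
    and "\<And>x t. x \<in> {0..l} \<Longrightarrow> t \<in> {0..T} \<Longrightarrow>
      ((\<lambda>\<tau>. p (x, \<tau>)) has_vector_derivative Q (x, t) *v lin_vel y (x, t)) (at t within {0..T})"
proof -
  note y' = y[unfolded E2_iff]
  have y1: "Ck_on 1 (rect l T) y" using y' by blast
  have Ck: "Ck_on (Suc 0) (rect l T) (lin_strain y)" "Ck_on (Suc 0) (rect l T) (lin_vel y)"
    using Ck_on_lin_strain[OF y1] Ck_on_lin_vel[OF y1] by (simp_all only: One_nat_def)
  note cont = Ck_on_imp_continuous_on[OF Ck(1)] Ck_on_imp_continuous_on[OF Ck_on_ang_vel[OF y1]]
    Ck_on_imp_continuous_on[OF Ck_on_partial_t[OF l T Ck(1)]]
  define g where "g q = Q q *v lin_strain y q" for q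
  \<comment> \<open>The product rule for \<open>g\<close>, with the t-derivative of \<open>Q\<close>
    replaced by its equation.\<close>
  define gt where "gt q = Q q *v partial_t T (lin_strain y) q + Q q ** hat (ang_vel y q) *v lin_strain y q" for q
  have g: "continuous_on (rect l T) g"
    unfolding g_def by (intro bounded_bilinear.continuous_on[OF bounded_bilinear_matrix_vector_mult] Q cont)
  have gt: "continuous_on (rect l T) gt"
    unfolding gt_def by (intro continuous_on_add bounded_bilinear.continuous_on[OF bounded_bilinear_matrix_vector_mult]
        bounded_bilinear.continuous_on[OF bounded_bilinear_matrix_mult]
        bounded_linear.continuous_on[OF bounded_linear_hat] Q cont)
  have dg: "((\<lambda>\<tau>. g (x, \<tau>)) has_vector_derivative gt (x, t)) (at t within {0..T})"
    if "x \<in> {0..l}" "t \<in> {0..T}" for x t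
    unfolding g_def gt_def
    by (intro has_vector_derivative_matrix_vector_mult dtQ has_partial_t[OF l T Ck(1)] that)
  define p where "p = (\<lambda>(x, t). fp + integral {0..x} (\<lambda>\<xi>. g (\<xi>, t)))"
  have dp: "((\<lambda>\<xi>. p (\<xi>, t)) has_vector_derivative g (x, t)) (at x within {0..l})"
    if "x \<in> {0..l}" "t \<in> {0..T}" for x t
  proof -
    have "continuous_on {0..l} (\<lambda>x. g (x, t))"
      by (rule continuous_on_compose2[OF g]) (use that in \<open>auto intro!: continuous_intros simp: rect_def\<close>)
    from has_vector_derivative_add[OF has_vector_derivative_const integral_has_vector_derivative[OF this that(1)]]
    show ?thesis by (simp add: p_def)
  qed
  have p0: "p (0, t) = fp" for t by (simp add: p_def)
  have "((\<lambda>t. p (x, t)) has_vector_derivative Q (x, t) *v lin_vel y (x, t)) (at t within {0..T})"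
    if x: "x \<in> {0..l}" and t: "t \<in> {0..T}" for x t
  proof (rule has_vector_derivative_parameter[OF l, where F = "\<lambda>x t. p (x, t)" and g = "\<lambda>x t. g (x, t)"])
    show "((\<lambda>x. Q (x, t) *v lin_vel y (x, t)) has_vector_derivative gt (x, t)) (at x within {0..l})"
      if x: "x \<in> {0..l}" for x
    proof -
      have q: "(x, t) \<in> rect l T" using x t by (simp add: rect_def)
      have "((\<lambda>x. Q (x, t) *v lin_vel y (x, t)) has_vector_derivative Q (x, t) *v partial_x l (lin_vel y) (x, t) +
          Q (x, t) ** hat (ang_strain y (x, t)) *v lin_vel y (x, t)) (at x within {0..l})"
        by (intro has_vector_derivative_matrix_vector_mult dQ has_partial_x[OF l T Ck(2)] x t)
      moreover have "partial_t T (lin_strain y) (x, t) = partial_x l (lin_vel y) (x, t)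
          + cross3 (ang_strain y (x, t)) (lin_vel y (x, t)) - cross3 (ang_vel y (x, t)) (lin_strain y (x, t))"
        using y' q by blast
      ultimately show ?thesis
        by (simp add: gt_def hat_mult matrix_vector_right_distrib matrix_vector_mult_diff_distrib
            flip: matrix_vector_mul_assoc)
    qed
    show "Q (0, t) *v lin_vel y (0, t) = 0" using y' t by simp
    show "\<exists>d>0. \<forall>\<tau>\<in>{0..T}. \<bar>\<tau> - t\<bar> < d \<longrightarrow>
        (\<forall>x\<in>{0..l}. norm (g (x, \<tau>) - g (x, t) - (\<tau> - t) *\<^sub>R gt (x, t)) \<le> e * \<bar>\<tau> - t\<bar>)" if "e > 0" for e
      by (rule uniform_linearization[OF dg gt t that])
  qed (use dp p0 x t in auto)
  then show thesis using that[of p] p0 dp by (simp add: g_def)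
qed

text \<open>The fields constructed from the equations in x must still be shown to be of class C^2
  and to match the initial data; then \<open>transf_eq_iff\<close> applies.\<close>

lemma E2_in_image_transf:
  assumes y: "y \<in> E2 l T C R p0 R0"
  shows "y \<in> transf l T C R ` E1 l T fp fR p0 R0"
proof -
  note y' = y[unfolded E2_iff]
  have y1: "Ck_on 1 (rect l T) y" and y_ext: "y \<in> extensional (rect l T)" using y' by blast+
  obtain Q where rot: "\<And>q. q \<in> rect l T \<Longrightarrow> rotation_matrix (Q q)" and Q0: "\<And>t. t \<in> {0..T} \<Longrightarrow> Q (0, t) = fR"
    and dQ: "\<And>x t. x \<in> {0..l} \<Longrightarrow> t \<in> {0..T} \<Longrightarrow>
      ((\<lambda>\<xi>. Q (\<xi>, t)) has_vector_derivative Q (x, t) ** hat (ang_strain y (x, t))) (at x within {0..l})"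
    and dtQ: "\<And>x t. x \<in> {0..l} \<Longrightarrow> t \<in> {0..T} \<Longrightarrow>
      ((\<lambda>\<tau>. Q (x, \<tau>)) has_vector_derivative Q (x, t) ** hat (ang_vel y (x, t))) (at t within {0..T})"
    using rotation_exists[OF y] by blast
  have strains: "Ck_on (Suc 0) (rect l T) (lin_strain y)" "Ck_on (Suc 0) (rect l T) (ang_strain y)"
    "Ck_on (Suc 0) (rect l T) (lin_vel y)" "Ck_on (Suc 0) (rect l T) (ang_vel y)"
    using Ck_on_lin_strain[OF y1] Ck_on_ang_strain[OF y1] Ck_on_lin_vel[OF y1] Ck_on_ang_vel[OF y1]
    by (simp_all only: One_nat_def)
  \<comment> \<open>Orthogonality bounds the partial derivatives of \<open>Q\<close> before
    \<open>Q\<close> is known to be jointly continuous.\<close>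
  have bounded: "\<exists>B. \<forall>q\<in>rect l T. norm (Q q ** hat (w q)) \<le> B" if w: "Ck_on (Suc 0) (rect l T) w" for w
  proof -
    obtain K where "K > 0" and K: "\<And>(A :: real^3^3) (B :: real^3^3). norm (A ** B) \<le> norm A * norm B * K"
      using bounded_bilinear.pos_bounded[OF bounded_bilinear_matrix_mult] by blast
    have "compact (rect l T)" by (simp add: rect_def compact_Times)
    moreover have "continuous_on (rect l T) (\<lambda>q. hat (w q))"
      using Ck_on_imp_continuous_on[OF Ck_on_hat[OF w]] .
    ultimately have "bounded ((\<lambda>q. hat (w q)) ` rect l T)"
      by (simp add: compact_continuous_image compact_imp_bounded)
    then obtain M where M: "\<And>q. q \<in> rect l T \<Longrightarrow> norm (hat (w q)) \<le> M" unfolding bounded_iff by blast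
    have "norm (Q q ** hat (w q)) \<le> CARD(3) * M * K" if q: "q \<in> rect l T" for q
    proof -
      have "norm (Q q) \<le> CARD(3)"
        using norm_orthogonal_matrix_le rot[OF q] rotation_matrix_def by blast
      then have "norm (Q q) * norm (hat (w q)) * K \<le> CARD(3) * M * K"
        using M[OF q] \<open>K > 0\<close> by (intro mult_right_mono mult_mono) auto
      with K[of "Q q" "hat (w q)"] show ?thesis by linarith
    qed
    then show ?thesis by blast
  qed
  obtain B B' where "\<And>q. q \<in> rect l T \<Longrightarrow> norm (Q q ** hat (ang_strain y q)) \<le> B"
    "\<And>q. q \<in> rect l T \<Longrightarrow> norm (Q q ** hat (ang_vel y q)) \<le> B'"
    using bounded[OF strains(2)] bounded[OF strains(4)] by blast
  with dQ dtQ have Qc: "continuous_on (rect l T) Q"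
    by (rule continuous_on_rect_if_bounded_partials)
  then have Ck0: "Ck_on 0 (rect l T) Q" by simp
  \<comment> \<open>Bootstrapping: both partial derivatives are products of \<open>Q\<close> with
    C^1 functions, so the class of \<open>Q\<close> can be raised from 0 to 1 and then to 2.\<close>
  have Ck1: "Ck_on (Suc 0) (rect l T) Q"
    by (rule Ck_on_rectI[OF dQ dtQ]; (assumption | intro Ck_on_matrix_mult Ck_on_hat Ck0
        Ck_on_Suc_imp[OF strains(2)] Ck_on_Suc_imp[OF strains(4)]))
  have CkQ: "Ck_on (Suc (Suc 0)) (rect l T) Q"
    by (rule Ck_on_rectI[OF dQ dtQ]; (assumption | intro Ck_on_matrix_mult Ck_on_hat Ck1 strains))
  obtain p where p0': "\<And>t. t \<in> {0..T} \<Longrightarrow> p (0, t) = fp"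
    and dp: "\<And>x t. x \<in> {0..l} \<Longrightarrow> t \<in> {0..T} \<Longrightarrow>
      ((\<lambda>\<xi>. p (\<xi>, t)) has_vector_derivative Q (x, t) *v lin_strain y (x, t)) (at x within {0..l})"
    and dtp: "\<And>x t. x \<in> {0..l} \<Longrightarrow> t \<in> {0..T} \<Longrightarrow>
      ((\<lambda>\<tau>. p (x, \<tau>)) has_vector_derivative Q (x, t) *v lin_vel y (x, t)) (at t within {0..T})"
    using position_exists[OF y dQ dtQ Qc] by blast
  have Ckp: "Ck_on (Suc (Suc 0)) (rect l T) p"
    by (rule Ck_on_rectI[OF dp dtp]; (assumption | intro Ck_on_matrix_vector_mult Ck1 strains))
  have zero: "0 \<in> {0..T}" "0 \<in> {0..l}" using T l by auto
  have d0: "(p0 has_vector_derivative R0 x *v lin_strain y (x, 0)) (at x within {0..l})"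
    "(R0 has_vector_derivative R0 x ** hat (ang_strain y (x, 0))) (at x within {0..l})" if "x \<in> {0..l}" for x
    using y' that by blast+
  \<comment> \<open>At t = 0 both rotations solve the same equation by the initial condition in
    \<open>E2\<close>, and they agree at x = 0 by the compatibility of the data.\<close>
  have Qx0: "Q (x, 0) = R0 x" if x: "x \<in> {0..l}" for x
    by (rule skew_ode_unique[OF dQ[OF _ zero(1)] d0(2) transpose_hat x])
       (use initial(2) x zero f_eq Q0 in auto)
  have px0: "p (x, 0) = p0 x" if x: "x \<in> {0..l}" for x
  proof -
    have "p (x, 0) - p0 x = p (0, 0) - p0 0"
    proof (rule has_vector_derivative_zero_imp_eq[OF _ x, of "\<lambda>x. p (x, 0) - p0 x"])
      show "((\<lambda>x. p (x, 0) - p0 x) has_vector_derivative 0) (at u within {0..l})" if "u \<in> {0..l}" for u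
        using has_vector_derivative_diff[OF dp[OF that zero(1)] d0(1)[OF that]] Qx0[OF that] by simp
    qed
    then show ?thesis using p0'[OF zero(1)] f_eq by simp
  qed
  \<comment> \<open>The restriction provides the extensionality required in
    \<open>E1\<close>.\<close>
  define P where "P = restrict (\<lambda>q. (p q, Q q)) (rect l T)"
  have P: "P q = (p q, Q q)" if "q \<in> rect l T" for q using that by (simp add: P_def)
  have CkP: "Ck_on 2 (rect l T) P"
    unfolding numeral_2_eq_2 by (rule Ck_on_cong[THEN iffD2, OF P Ck_on_Pair[OF Ckp CkQ]])
  have PE1: "P \<in> E1 l T fp fR p0 R0"
    unfolding E1_iff
    using CkP rot P p0' Q0 px0 Qx0 zero by (auto simp: P_def rect_def simp del: Ck_on.simps)
  have "transf l T C R P = y"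
  proof (rule transf_eq_iff[THEN iffD2])
    show "\<forall>q\<in>rect l T. partial_x l (\<lambda>q. fst (P q)) q = snd (P q) *v lin_strain y q \<and>
     partial_t T (\<lambda>q. fst (P q)) q = snd (P q) *v lin_vel y q \<and>
     partial_x l (\<lambda>q. snd (P q)) q = snd (P q) ** hat (ang_strain y q) \<and>
     partial_t T (\<lambda>q. snd (P q)) q = snd (P q) ** hat (ang_vel y q)"
    proof
      fix q assume q: "q \<in> rect l T"
      obtain x t where xt: "q = (x, t)" and x: "x \<in> {0..l}" and t: "t \<in> {0..T}"
        using q unfolding rect_def by blast
      have P': "\<xi> \<in> {0..l} \<Longrightarrow> P (\<xi>, t) = (p (\<xi>, t), Q (\<xi>, t))"
        "\<tau> \<in> {0..T} \<Longrightarrow> P (x, \<tau>) = (p (x, \<tau>), Q (x, \<tau>))" for \<xi> \<tau>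
        using P x t by (simp_all add: rect_def)
      have "partial_x l (\<lambda>q. fst (P q)) (x, t) = Q (x, t) *v lin_strain y (x, t)"
        by (rule partial_x_eqI[OF l x], rule has_vector_derivative_transform[OF x _ dp[OF x t]])
           (simp add: P')
      moreover have "partial_t T (\<lambda>q. fst (P q)) (x, t) = Q (x, t) *v lin_vel y (x, t)"
        by (rule partial_t_eqI[OF T t], rule has_vector_derivative_transform[OF t _ dtp[OF x t]])
           (simp add: P')
      moreover have "partial_x l (\<lambda>q. snd (P q)) (x, t) = Q (x, t) ** hat (ang_strain y (x, t))"
        by (rule partial_x_eqI[OF l x], rule has_vector_derivative_transform[OF x _ dQ[OF x t]])
           (simp add: P')
      moreover have "partial_t T (\<lambda>q. snd (P q)) (x, t) = Q (x, t) ** hat (ang_vel y (x, t))"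
        by (rule partial_t_eqI[OF T t], rule has_vector_derivative_transform[OF t _ dtQ[OF x t]])
           (simp add: P')
      ultimately show "partial_x l (\<lambda>q. fst (P q)) q = snd (P q) *v lin_strain y q \<and>
         partial_t T (\<lambda>q. fst (P q)) q = snd (P q) *v lin_vel y q \<and>
         partial_x l (\<lambda>q. snd (P q)) q = snd (P q) ** hat (ang_strain y q) \<and>
         partial_t T (\<lambda>q. snd (P q)) q = snd (P q) ** hat (ang_vel y q)"
        using P[OF q] by (simp add: xt)
    qed
  qed (use CkP rot P y_ext in auto)
  with PE1 show ?thesis by blast
qed

lemma bij_betw_transf:
  "bij_betw (transf l T C R) (E1 l T fp fR p0 R0) (E2 l T C R p0 R0)"
  unfolding bij_betw_def using inj_on_transf transf_in_E2 E2_in_image_transf by blast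

end

theorem theorem3p3p1:
  fixes T l :: real
    and C :: "real \<Rightarrow> real^(3 + 3)^(3 + 3)"
    and R :: "real \<Rightarrow> real^3^3"
    and fp :: "real^3" and fR :: "real^3^3"
    and p0 :: "real \<Rightarrow> real^3" and R0 :: "real \<Rightarrow> real^3^3"
  assumes "T > 0" and "l > 0"
    and "Ck_on 1 {0..l} C"
    and "\<And>x. x \<in> {0..l} \<Longrightarrow> transpose (C x) = C x"
    and "\<And>x w. x \<in> {0..l} \<Longrightarrow> w \<noteq> 0 \<Longrightarrow> w \<bullet> (C x *v w) > 0"
    and "Ck_on 2 {0..l} R"
    and "\<And>x. x \<in> {0..l} \<Longrightarrow> rotation_matrix (R x)"
    and "rotation_matrix fR"
    and "Ck_on 2 {0..l} (\<lambda>x. (p0 x, R0 x))"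
    and "\<And>x. x \<in> {0..l} \<Longrightarrow> rotation_matrix (R0 x)"
    and "(fp, fR) = (p0 0, R0 0)"
  shows "bij_betw (transf l T C R) (E1 l T fp fR p0 R0) (E2 l T C R p0 R0)"
proof -
  interpret beam T l C R fp fR p0 R0
    by unfold_locales (fact assms)+
  show ?thesis by (rule bij_betw_transf)
qed

end
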